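(* Let $\Phi:[0,\infty)\to[0,\infty)$ be convex and non-decreasing and let $(\mu_n)$ be a sequence of reals. In the setting described in the context, suppose there exists $\epsilon_o>0$ such that the random transformation $\mathcal R$ satisfies assumption (A1). Let $\alpha:=\frac13P(Z_1=\mathbf A,Z_3=\mathbf B)$ and $b(q):=\sqrt{2\pi q(1-q)}\exp\big[\frac{1}{2q(1-q)}\big]$. Then for every constant $c_o$ with $0<c_o<\frac{\sqrt{2\alpha}}{8\,b(q)}$ and every sufficiently large $n$, $$E\,\Phi\big(|L(Z)-\mu_n|\big)\ \ge\ c_o\,\Phi\Big(\frac{\epsilon_o\sqrt{2\alpha n}}{16}\Big).$$
   Context: Let $\mathbb A$ be a finite alphabet, $S:\mathbb A\times\mathbb A\to[0,\infty)$ a pairwise scoring function and $\delta\in\mathbb R$. For $X=(X_1,\dots,X_n),Y=(Y_1,\dots,Y_n)\in\mathbb A^n$, an alignment is a pair $(\rho,\tau)$ of increasing sequences $1\le\rho_1<\dots<\rho_k\le n$, $1\le\tau_1<\dots<\tau_k\le n$ ($k\ge0$), with score $\sum_{i=1}^kS(X_{\rho_i},Y_{\tau_i})+\delta(n-k)$; $L(Z)=L(X,Y)$ is the maximum of this score over all alignments, where $Z=((X_1,Y_1),\dots,(X_n,Y_n))$. Let $(Z_i)_{i\ge1}$, $Z_i=(X_i,Y_i)$, be a stationary aperiodic Markov chain on $\mathbb A\times\mathbb A$ with transition matrix $(p_{\mathbf E\mathbf F})$, some power of which has all entries strictly positive, and $Z=(Z_1,\dots,Z_n)$. Fix $\mathbf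 A,\mathbf B\in\mathbb A\times\mathbb A$ with $P(Z_1=\mathbf A,Z_3=\mathbf B)>0$ and $\mathbf D\in\mathbb A\times\mathbb A$ such that $q:=\frac{p_{\mathbf A\mathbf D}p_{\mathbf D\mathbf B}}{\sum_{\mathbf D'}p_{\mathbf A\mathbf D'}p_{\mathbf D'\mathbf B}}\in(0,1)$. For $z\in(\mathbb A\times\mathbb A)^n$ and $m=\lfloor n/3\rfloor$, let $\mathfrak n_i(z)=1$ if $z_{3i-2}=\mathbf A$ and $z_{3i}=\mathbf B$ and $0$ otherwise ($i=1,\dots,m$), $\mathfrak v(z)=\sum_i\mathfrak n_i(z)$, $\mathfrak u(z)=\sum_i\mathfrak n_i(z)\mathbf 1\{z_{3i-1}=\mathbf D\}$. The random transformation $\mathcal R$ (with randomness independent of $Z$) acts on $z$ with $\mathfrak u(z)<\mathfrak v(z)$ by choosing uniformly at random an index $i$ with $\mathfrak n_i(z)=1$ and $z_{3i-1}\ne\mathbf D$ and replacing $z_{3i-1}$ by $\mathbf D$; if $\mathfrak u(z)=\mathfrak v(z)$ we set $\mathcal R(z)=z$. Assumption (A1): there is a sequence $\Delta_n\to0$ such that $P\big(E[L(\mathcal R(Z))-L(Z)\mid Z]\ge\epsilon_o\big)\ge1-\Delta_n$ for all $n$, where the conditional expectation is over the randomness of $\mathcal R$. *)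

theory Defs
  imports "HOL-Analysis.Analysis"
begin

text \<open>Sequences z = (z_1,...,z_n) over the state space 'a \<times> 'a are modelled as
  extensional functions on {1..n} (1-based indices).\<close>

definition seqs :: "nat \<Rightarrow> (nat \<Rightarrow> 'e) set" where
  "seqs n = PiE {1..n} (\<lambda>_. UNIV)"

definition mc_pmf :: "('e \<Rightarrow> real) \<Rightarrow> ('e \<Rightarrow> 'e \<Rightarrow> real) \<Rightarrow> nat \<Rightarrow> (nat \<Rightarrow> 'e) \<Rightarrow> real" where
  "mc_pmf ini p n z = (if n = 0 then 1 else ini (z 1) * (\<Prod>i\<in>{1..<n}. p (z i) (z (Suc i))))"

definition mc_prob :: "('e::finite \<Rightarrow> real) \<Rightarrow> ('e \<Rightarrow> 'e \<Rightarrow> real) \<Rightarrow> nat \<Rightarrow> ((nat \<Rightarrow> 'e) \<Rightarrow> bool) \<Rightarrow> real" where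
  "mc_prob ini p n P = (\<Sum>z\<in>{z\<in>seqs n. P z}. mc_pmf ini p n z)"

definition mc_expect :: "('e::finite \<Rightarrow> real) \<Rightarrow> ('e \<Rightarrow> 'e \<Rightarrow> real) \<Rightarrow> nat \<Rightarrow> ((nat \<Rightarrow> 'e) \<Rightarrow> real) \<Rightarrow> real" where
  "mc_expect ini p n f = (\<Sum>z\<in>seqs n. mc_pmf ini p n z * f z)"

fun mpow :: "('e::finite \<Rightarrow> 'e \<Rightarrow> real) \<Rightarrow> nat \<Rightarrow> 'e \<Rightarrow> 'e \<Rightarrow> real" where
  "mpow p 0 E F = (if E = F then 1 else 0)"
| "mpow p (Suc k) E F = (\<Sum>G\<in>UNIV. mpow p k E G * p G F)"

definition stochastic_matrix :: "('e::finite \<Rightarrow> 'e \<Rightarrow> real) \<Rightarrow> bool" where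
  "stochastic_matrix p \<longleftrightarrow> (\<forall>E F. 0 \<le> p E F) \<and> (\<forall>E. (\<Sum>F\<in>UNIV. p E F) = 1)"

definition primitive_matrix :: "('e::finite \<Rightarrow> 'e \<Rightarrow> real) \<Rightarrow> bool" where
  "primitive_matrix p \<longleftrightarrow> (\<exists>k\<ge>1. \<forall>E F. 0 < mpow p k E F)"

definition stationary_dist :: "('e::finite \<Rightarrow> real) \<Rightarrow> ('e \<Rightarrow> 'e \<Rightarrow> real) \<Rightarrow> bool" where
  "stationary_dist ini p \<longleftrightarrow> (\<forall>E. 0 \<le> ini E) \<and> (\<Sum>E\<in>UNIV. ini E) = 1
      \<and> (\<forall>F. (\<Sum>E\<in>UNIV. ini E * p E F) = ini F)"

definition alignments :: "nat \<Rightarrow> (nat list \<times> nat list) set" where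
  "alignments n = {(r, t). length r = length t \<and> sorted_wrt (<) r \<and> sorted_wrt (<) t
                       \<and> set r \<subseteq> {1..n} \<and> set t \<subseteq> {1..n}}"

definition align_score :: "('a \<Rightarrow> 'a \<Rightarrow> real) \<Rightarrow> real \<Rightarrow> nat \<Rightarrow> (nat \<Rightarrow> 'a \<times> 'a)
     \<Rightarrow> nat list \<times> nat list \<Rightarrow> real" where
  "align_score S \<delta> n z rt = (case rt of (r, t) \<Rightarrow>
     (\<Sum>i<length r. S (fst (z (r ! i))) (snd (z (t ! i)))) + \<delta> * (real n - real (length r)))"

definition LS :: "('a \<Rightarrow> 'a \<Rightarrow> real) \<Rightarrow> real \<Rightarrow> nat \<Rightarrow> (nat \<Rightarrow> 'a \<times> 'a) \<Rightarrow> real" where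
  "LS S \<delta> n z = Max (align_score S \<delta> n z ` alignments n)"

definition nblk :: "'e \<Rightarrow> 'e \<Rightarrow> (nat \<Rightarrow> 'e) \<Rightarrow> nat \<Rightarrow> bool" where
  "nblk A B z i \<longleftrightarrow> z (3*i - 2) = A \<and> z (3*i) = B"

definition vcnt :: "'e \<Rightarrow> 'e \<Rightarrow> nat \<Rightarrow> (nat \<Rightarrow> 'e) \<Rightarrow> nat" where
  "vcnt A B n z = card {i\<in>{1..n div 3}. nblk A B z i}"

definition ucnt :: "'e \<Rightarrow> 'e \<Rightarrow> 'e \<Rightarrow> nat \<Rightarrow> (nat \<Rightarrow> 'e) \<Rightarrow> nat" where
  "ucnt A B D n z = card {i\<in>{1..n div 3}. nblk A B z i \<and> z (3*i - 1) = D}"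

definition cands :: "'e \<Rightarrow> 'e \<Rightarrow> 'e \<Rightarrow> nat \<Rightarrow> (nat \<Rightarrow> 'e) \<Rightarrow> nat set" where
  "cands A B D n z = {i\<in>{1..n div 3}. nblk A B z i \<and> z (3*i - 1) \<noteq> D}"

text \<open>E[L(R(z)) - L(z) | Z = z]: average over uniformly chosen candidate index.\<close>
definition R_gain :: "('a \<Rightarrow> 'a \<Rightarrow> real) \<Rightarrow> real \<Rightarrow> 'a \<times> 'a \<Rightarrow> 'a \<times> 'a \<Rightarrow> 'a \<times> 'a
     \<Rightarrow> nat \<Rightarrow> (nat \<Rightarrow> 'a \<times> 'a) \<Rightarrow> real" where
  "R_gain S \<delta> A B D n z =
     (if ucnt A B D n z < vcnt A B n z then
        (\<Sum>i\<in>cands A B D n z. LS S \<delta> n (z(3*i - 1 := D)) - LS S \<delta> n z) / real (card (cands A B D n z))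
      else 0)"

end

theory Submission
  imports Defs "HOL-Real_Asymp.Real_Asymp"
begin

text \<open>
  Given \<open>V = v\<close>, the number \<open>U\<close> of marked blocks filled with \<open>D\<close> is binomial with parameters \<open>v\<close> and
  \<open>q\<close>, and the random transformation carries the conditional law at \<open>U = u\<close> to the one at
  \<open>U = u + 1\<close>. Hence \<open>l(u) = E[L | U = u, V = v]\<close> has increments \<open>E[gain | U = u, V = v]\<close>. The gain is
  bounded, and it is at least \<open>\<epsilon>\<close> off an event of probability at most \<open>\<Delta>\<^sub>n\<close>. Binomial
  probabilities are at least \<open>\<kappa> / sqrt v\<close> on the window \<open>\<bar>u - q v\<bar> \<le> sqrt v / 4\<close>, so the bad events
  cost only \<open>O(\<Delta>\<^sub>n sqrt v)\<close> in total there, and \<open>l\<close> grows over the window essentially with slope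
  \<open>\<epsilon>\<close>. It can therefore stay within \<open>x\<close> of \<open>\<mu>\<^sub>n\<close> for at most about \<open>2 x / \<epsilon>\<close> values of \<open>u\<close>,
  and the remaining ones have probability bounded below; Jensen's inequality turns this into
  the moment bound. That \<open>V \<ge> \<alpha> n / 2\<close> with probability tending to 1 follows from Chebyshev's
  inequality and the mixing of the chain. The constant \<open>sqrt (2 \<alpha>) / (8 b(q))\<close> leaves enough room
  that Chebyshev's inequality and crude ratio estimates replace a sharp local limit theorem.
\<close>

subsection \<open>Finite Markov chains\<close>

lemma finite_seqs [simp]: "finite (seqs n :: (nat \<Rightarrow> 'e::finite) set)"
  unfolding seqs_def by (intro finite_PiE) auto

lemma sum_seqs_Suc:
  fixes f :: "(nat \<Rightarrow> 'e::finite) \<Rightarrow> real"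
  shows "(\<Sum>z\<in>seqs (Suc n). f z) = (\<Sum>z\<in>seqs n. \<Sum>y\<in>UNIV. f (z(Suc n := y)))"
proof -
  have "(\<Sum>z\<in>seqs n. \<Sum>y\<in>UNIV. f (z(Suc n := y)))
      = (\<Sum>(z, y)\<in>seqs n \<times> UNIV. f (z(Suc n := y)))"
    by (simp add: sum.cartesian_product)
  also have "\<dots> = (\<Sum>z\<in>seqs (Suc n). f z)"
    \<comment> \<open>The inverse of the extension resets coordinate \<open>Suc n\<close> to
      \<open>undefined\<close>, the value that an extensional sequence of length \<open>n\<close>
      has there.\<close>
    by (rule sum.reindex_bij_witness
          [of _ "\<lambda>z. (z(Suc n := undefined), z (Suc n))" "\<lambda>(z, y). z(Suc n := y)"])
       (auto simp: seqs_def PiE_def extensional_def fun_eq_iff)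
  finally show ?thesis by simp
qed

text \<open>The step from length 0 to length 1 is excluded: there the new letter is drawn from
  \<open>ini\<close>, not from a row of \<open>p\<close>.\<close>

lemma mc_pmf_Suc:
  assumes "1 \<le> n"
  shows "mc_pmf ini p (Suc n) (z(Suc n := y)) = mc_pmf ini p n z * p (z n) y"
proof -
  have "(\<Prod>i\<in>{1..<Suc n}. p ((z(Suc n := y)) i) ((z(Suc n := y)) (Suc i)))
      = (\<Prod>i\<in>{1..<n}. p ((z(Suc n := y)) i) ((z(Suc n := y)) (Suc i))) * p (z n) y"
    using assms by (simp add: prod.atLeastLessThan_Suc)
  also have "(\<Prod>i\<in>{1..<n}. p ((z(Suc n := y)) i) ((z(Suc n := y)) (Suc i)))
      = (\<Prod>i\<in>{1..<n}. p (z i) (z (Suc i)))"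
    by (intro prod.cong) auto
  finally show ?thesis
    using assms by (simp add: mc_pmf_def)
qed

lemma mc_expect_Suc:
  assumes "1 \<le> n"
  shows "mc_expect ini p (Suc n) f
       = mc_expect ini p n (\<lambda>z. \<Sum>y\<in>UNIV. p (z n) y * f (z(Suc n := y)))"
  unfolding mc_expect_def sum_seqs_Suc mc_pmf_Suc[OF assms]
  by (simp add: sum_distrib_left mult.assoc)

lemma mc_expect_1: "mc_expect ini p 1 (\<lambda>z. g (z 1)) = (\<Sum>E\<in>UNIV. ini E * g E)"
  unfolding mc_expect_def One_nat_def sum_seqs_Suc
  by (simp add: seqs_def mc_pmf_def)

lemma mc_prob_eq_expect: "mc_prob ini p n P = mc_expect ini p n (\<lambda>z. of_bool (P z))"
  unfolding mc_prob_def mc_expect_def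
  by (rule sum.mono_neutral_cong_left) auto

lemma mc_expect_cong:
  "(\<And>z. z \<in> seqs n \<Longrightarrow> f z = g z) \<Longrightarrow> mc_expect ini p n f = mc_expect ini p n g"
  unfolding mc_expect_def by (intro sum.cong) auto

lemma mc_expect_cmult: "mc_expect ini p n (\<lambda>z. c * f z) = c * mc_expect ini p n f"
  unfolding mc_expect_def by (simp add: sum_distrib_left mult_ac)

lemma mc_expect_add:
  "mc_expect ini p n (\<lambda>z. f z + g z) = mc_expect ini p n f + mc_expect ini p n g"
  unfolding mc_expect_def by (simp add: sum.distrib distrib_left)

lemma mc_expect_sum:
  "mc_expect ini p n (\<lambda>z. \<Sum>i\<in>I. f i z) = (\<Sum>i\<in>I. mc_expect ini p n (f i))"
  unfolding mc_expect_def sum_distrib_left by (rule sum.swap)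

lemma mc_pmf_nonneg:
  assumes "stochastic_matrix p" "stationary_dist ini p"
  shows "0 \<le> mc_pmf ini p n z"
  using assms unfolding mc_pmf_def stochastic_matrix_def stationary_dist_def
  by (auto intro!: mult_nonneg_nonneg prod_nonneg)

lemma mc_expect_mono:
  assumes "stochastic_matrix p" "stationary_dist ini p"
    and "\<And>z. z \<in> seqs n \<Longrightarrow> f z \<le> g z"
  shows "mc_expect ini p n f \<le> mc_expect ini p n g"
  unfolding mc_expect_def
  using assms by (intro sum_mono mult_left_mono mc_pmf_nonneg) auto

text \<open>Rows of a stochastic matrix sum to 1, so the letters beyond \<open>k\<close> integrate
  out one at a time. That \<open>f\<close> depends on the first \<open>k\<close> letters only is
  expressed as agreement on sequences sharing them.\<close>

lemma mc_expect_prefix: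
  assumes st: "stochastic_matrix p" and k: "1 \<le> k" "k \<le> n"
    and f: "\<And>z z'. (\<And>i. i \<in> {1..k} \<Longrightarrow> z i = z' i) \<Longrightarrow> f z = f z'"
  shows "mc_expect ini p n f = mc_expect ini p k f"
  using k(2)
proof (induction n rule: dec_induct)
  case (step n)
  have "f (z(Suc n := y)) = f z" for z y
    using step by (intro f) auto
  moreover have "(\<Sum>y\<in>UNIV. p E y * c) = c" for E c
    using st by (simp add: stochastic_matrix_def flip: sum_distrib_right)
  ultimately have "mc_expect ini p (Suc n) f = mc_expect ini p n f"
    using step k by (simp add: mc_expect_Suc)
  then show ?case using step by simp
qed simp

text \<open>The Markov property at time \<open>k\<close>: the past factor \<open>f\<close> stays,
  and the later letters collapse into a power of \<open>p\<close>. The end state \<open>y\<close> is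
  kept general because the induction peels off the last transition and lands on every possible
  predecessor.\<close>

lemma mc_expect_markov:
  assumes k: "1 \<le> k" "k \<le> n"
    and f: "\<And>z z'. (\<And>i. i \<in> {1..k} \<Longrightarrow> z i = z' i) \<Longrightarrow> f z = f z'"
  shows "mc_expect ini p n (\<lambda>z. f z * of_bool (z n = y))
       = mc_expect ini p k (\<lambda>z. f z * mpow p (n - k) (z k) y)"
  using k(2)
proof (induction n arbitrary: y rule: dec_induct)
  case base
  show ?case by (intro mc_expect_cong) auto
next
  case (step n)
  have *: "f (z(Suc n := y)) = f z" for z y
    using step by (intro f) auto
  have "(\<Sum>x\<in>UNIV. p E x * (c * of_bool (x = y))) = c * p E y" for E c
    by (simp add: of_bool_def if_distrib cong: if_cong)
  then have "mc_expect ini p (Suc n) (\<lambda>z. f z * of_bool (z (Suc n) = y))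
      = mc_expect ini p n (\<lambda>z. f z * p (z n) y)"
    using step k by (simp add: mc_expect_Suc *)
  also have "\<dots> = mc_expect ini p n (\<lambda>z. \<Sum>G\<in>UNIV. p G y * (f z * of_bool (z n = G)))"
    by (intro mc_expect_cong) (simp add: of_bool_def if_distrib cong: if_cong)
  also have "\<dots> = (\<Sum>G\<in>UNIV. p G y * mc_expect ini p k (\<lambda>z. f z * mpow p (n - k) (z k) G))"
    by (simp add: mc_expect_sum mc_expect_cmult step.IH)
  also have "\<dots> = mc_expect ini p k (\<lambda>z. \<Sum>G\<in>UNIV. p G y * (f z * mpow p (n - k) (z k) G))"
    by (simp add: mc_expect_sum mc_expect_cmult)
  also have "\<dots> = mc_expect ini p k (\<lambda>z. f z * mpow p (Suc n - k) (z k) y)"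
    using step by (intro mc_expect_cong) (simp add: Suc_diff_le sum_distrib_left mult_ac)
  finally show ?case .
qed

section \<open>Powers of the transition matrix and convergence to the stationary law\<close>

lemma mpow_add: "mpow p (k + l) E F = (\<Sum>G\<in>UNIV. mpow p k E G * mpow p l G F)"
proof (induction l arbitrary: F)
  case 0
  show ?case by (simp add: if_distrib cong: if_cong)
next
  case (Suc l)
  have "mpow p (k + Suc l) E F = (\<Sum>H\<in>UNIV. \<Sum>G\<in>UNIV. mpow p k E G * mpow p l G H * p H F)"
    by (simp add: Suc sum_distrib_right)
  also have "\<dots> = (\<Sum>G\<in>UNIV. \<Sum>H\<in>UNIV. mpow p k E G * mpow p l G H * p H F)"
    by (rule sum.swap)
  finally show ?case by (simp add: sum_distrib_left mult.assoc)
qed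

lemma mpow_stochastic:
  assumes "stochastic_matrix p"
  shows "stochastic_matrix (mpow p k)"
proof (induction k)
  case 0
  show ?case by (simp add: stochastic_matrix_def)
next
  case (Suc k)
  have "(\<Sum>F\<in>UNIV. mpow p (Suc k) E F) = (\<Sum>G\<in>UNIV. mpow p k E G * (\<Sum>F\<in>UNIV. p G F))" for E
    unfolding mpow.simps sum_distrib_left by (rule sum.swap)
  with Suc assms show ?case
    by (auto simp: stochastic_matrix_def intro!: sum_nonneg)
qed

lemma stationary_dist_mpow:
  assumes "stationary_dist ini p"
  shows "(\<Sum>E\<in>UNIV. ini E * mpow p k E F) = ini F"
proof (induction k arbitrary: F)
  case 0
  show ?case by (simp add: if_distrib cong: if_cong)
next
  case (Suc k)
  have "(\<Sum>E\<in>UNIV. ini E * mpow p (Suc k) E F)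
      = (\<Sum>E\<in>UNIV. \<Sum>G\<in>UNIV. ini E * mpow p k E G * p G F)"
    by (simp add: sum_distrib_left mult.assoc)
  also have "\<dots> = (\<Sum>G\<in>UNIV. \<Sum>E\<in>UNIV. ini E * mpow p k E G * p G F)"
    by (rule sum.swap)
  finally show ?case using Suc assms
    by (simp add: stationary_dist_def flip: sum_distrib_right)
qed

text \<open>A row with all entries at least \<open>\<eta>\<close> gives weight at least
  \<open>\<eta>\<close> to a point where \<open>f\<close> attains its minimum \<open>m\<close>; this
  pulls the average below \<open>M\<close> by that share of the oscillation.\<close>

lemma stochastic_avg_bounds:
  assumes "stochastic_matrix p" "\<And>G. m \<le> f G" "\<And>G. f G \<le> M"
    and "\<And>G. \<eta> \<le> p E G" "f G0 = m"
  shows "(\<Sum>G\<in>UNIV. p E G * f G) \<le> M - \<eta> * (M - m)"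
    and "m \<le> (\<Sum>G\<in>UNIV. p E G * f G)"
proof -
  have one: "(\<Sum>G\<in>UNIV. p E G) = 1" and nn: "\<And>G. 0 \<le> p E G"
    using assms by (auto simp: stochastic_matrix_def)
  have "\<eta> * (M - m) \<le> p E G0 * (M - f G0)"
    using assms(4)[of G0] assms(3)[of G0] assms(5) by (auto intro!: mult_right_mono)
  also have "\<dots> \<le> (\<Sum>G\<in>UNIV. p E G * (M - f G))"
    using nn assms(3) by (intro member_le_sum) auto
  also have "\<dots> = M - (\<Sum>G\<in>UNIV. p E G * f G)"
    using one by (simp add: right_diff_distrib sum_subtractf flip: sum_distrib_right)
  finally show "(\<Sum>G\<in>UNIV. p E G * f G) \<le> M - \<eta> * (M - m)" by simp
  have "(\<Sum>G\<in>UNIV. p E G * m) \<le> (\<Sum>G\<in>UNIV. p E G * f G)"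
    using nn assms(2) by (intro sum_mono mult_left_mono) auto
  then show "m \<le> (\<Sum>G\<in>UNIV. p E G * f G)"
    using one by (simp flip: sum_distrib_right)
qed

text \<open>Doeblin's argument: the oscillation of a column of \<^term>\<open>mpow p k\<close> shrinks by a fixed factor
  whenever \<^term>\<open>k\<close> grows by a positivity exponent of \<^term>\<open>p\<close>.\<close>

lemma mpow_tendsto_stationary:
  fixes p :: "'e::finite \<Rightarrow> 'e \<Rightarrow> real"
  assumes st: "stochastic_matrix p" and pr: "primitive_matrix p" and stat: "stationary_dist ini p"
  shows "(\<lambda>k. mpow p k E F) \<longlonglongrightarrow> ini F"
proof -
  obtain r where r: "r \<ge> 1" "\<And>E F. 0 < mpow p r E F"
    using pr by (auto simp: primitive_matrix_def)
  define \<eta> where "\<eta> = Min (range (\<lambda>(E, F). mpow p r E F))"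
  have \<eta>: "\<eta> \<le> mpow p r E F" for E F
    unfolding \<eta>_def by (rule Min_le) force+
  have "\<eta> \<in> range (\<lambda>(E, F). mpow p r E F)"
    unfolding \<eta>_def by (intro Min_in) auto
  then have \<eta>0: "0 < \<eta>" using r by auto
  define M where "M k = Max (range (\<lambda>E. mpow p k E F))" for k
  define m where "m k = Min (range (\<lambda>E. mpow p k E F))" for k
  have M: "mpow p k E F \<le> M k" and m: "m k \<le> mpow p k E F" for k E
    unfolding M_def m_def by (auto intro: Max_ge Min_le)
  have M': "\<exists>E. M k = mpow p k E F" and m': "\<exists>E. m k = mpow p k E F" for k
    using Max_in[of "range (\<lambda>E. mpow p k E F)"] Min_in[of "range (\<lambda>E. mpow p k E F)"]
    unfolding M_def m_def image_iff by auto
  \<comment> \<open>\<open>\<theta>\<close> is left free: with \<open>\<eta>\<close> and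
    \<open>l = r\<close> the oscillation contracts, with 0 and any \<open>l\<close> it does not
    increase.\<close>
  have step: "M (l + k) - m (l + k) \<le> (1 - \<theta>) * (M k - m k)"
    if "\<And>E F. \<theta> \<le> mpow p l E F" for l k \<theta>
  proof -
    obtain G0 where "mpow p k G0 F = m k" using m' by metis
    note b = stochastic_avg_bounds[where p = "mpow p l" and f = "\<lambda>G. mpow p k G F",
        OF mpow_stochastic[OF st] m M that this, unfolded mpow_add[symmetric]]
    obtain E1 E2 where "M (l + k) = mpow p (l + k) E1 F" "m (l + k) = mpow p (l + k) E2 F"
      using M' m' by metis
    then show ?thesis using b(1)[of E1] b(2)[of E2] by (simp add: algebra_simps)
  qed
  have anti: "M (l + k) - m (l + k) \<le> M k - m k" for l k
    using step[of 0 l k] mpow_stochastic[OF st, of l] by (simp add: stochastic_matrix_def)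
  have mM: "m k \<le> M k" for k using m[of k E] M[of k E] by simp
  have \<eta>1: "\<eta> \<le> 1"
  proof -
    have "mpow p r E E \<le> (\<Sum>F\<in>UNIV. mpow p r E F)"
      using mpow_stochastic[OF st, of r] by (intro member_le_sum) (auto simp: stochastic_matrix_def)
    also have "\<dots> = 1"
      using mpow_stochastic[OF st, of r] by (auto simp: stochastic_matrix_def)
    finally show ?thesis using \<eta>[of E E] by simp
  qed
  have pow: "M (r * t) - m (r * t) \<le> (1 - \<eta>) ^ t * (M 0 - m 0)" for t
  proof (induction t)
    case (Suc t)
    have "M (r * Suc t) - m (r * Suc t) \<le> (1 - \<eta>) * (M (r * t) - m (r * t))"
      using step[OF \<eta>, of "r * t"] by simp
    also have "\<dots> \<le> (1 - \<eta>) * ((1 - \<eta>) ^ t * (M 0 - m 0))"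
      using Suc \<eta>1 by (intro mult_left_mono) auto
    finally show ?case by (simp add: mult_ac)
  qed simp
  have lim: "(\<lambda>k. M k - m k) \<longlonglongrightarrow> 0"
  proof (rule LIMSEQ_I)
    fix e :: real assume e: "0 < e"
    have "(\<lambda>t. (1 - \<eta>) ^ t * (M 0 - m 0)) \<longlonglongrightarrow> 0 * (M 0 - m 0)"
      using \<eta>0 \<eta>1 by (intro tendsto_intros LIMSEQ_realpow_zero) auto
    then obtain t where t: "(1 - \<eta>) ^ t * (M 0 - m 0) < e"
      using e order_tendstoD(2)[of _ 0 sequentially e] by (auto simp: eventually_sequentially)
    \<comment> \<open>Contraction controls only the multiples of \<open>r\<close>; monotonicity
      carries the bound to all later \<open>k\<close>.\<close>
    have "norm (M k - m k - 0) < e" if "k \<ge> r * t" for k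
      using anti[of "k - r * t" "r * t"] pow[of t] t mM[of k] that by simp
    then show "\<exists>no. \<forall>k\<ge>no. norm (M k - m k - 0) < e" by blast
  qed
  \<comment> \<open>By stationarity \<open>ini F\<close> is an average over column \<open>F\<close>
    of the power, so it lies between the extremes of that column, as does every entry.\<close>
  have "norm (mpow p k E F - ini F) \<le> M k - m k" for k
  proof -
    have i: "(\<Sum>E\<in>UNIV. ini E) = 1" "\<And>E. 0 \<le> ini E"
      using stat by (auto simp: stationary_dist_def)
    have "(\<Sum>E\<in>UNIV. ini E * mpow p k E F) \<le> (\<Sum>E\<in>UNIV. ini E * M k)"
         "(\<Sum>E\<in>UNIV. ini E * m k) \<le> (\<Sum>E\<in>UNIV. ini E * mpow p k E F)"
      using i M m by (auto intro!: sum_mono mult_left_mono)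
    then have "ini F \<le> M k" "m k \<le> ini F"
      using i by (simp_all add: stationary_dist_mpow[OF stat] flip: sum_distrib_right)
    then show ?thesis using M[of k E] m[of k E] by auto
  qed
  then have "(\<lambda>k. mpow p k E F - ini F) \<longlonglongrightarrow> 0"
    by (intro Lim_null_comparison[OF always_eventually lim] allI)
  then show ?thesis by (simp add: LIM_zero_iff)
qed

subsection \<open>The number of marked blocks\<close>

lemma mc_expect_const:
  assumes "stochastic_matrix p" "stationary_dist ini p" "1 \<le> n"
  shows "mc_expect ini p n (\<lambda>_. c) = c"
proof -
  have "mc_expect ini p n (\<lambda>_. c) = mc_expect ini p 1 (\<lambda>_. c)"
    using assms by (intro mc_expect_prefix) auto
  also have "\<dots> = c"
    using mc_expect_1[of ini p "\<lambda>_. c"] assms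
    by (simp add: stationary_dist_def flip: sum_distrib_right)
  finally show ?thesis .
qed

lemma mc_expect_state:
  assumes "stationary_dist ini p" "1 \<le> n"
  shows "mc_expect ini p n (\<lambda>z. of_bool (z n = E)) = ini E"
  using mc_expect_markov[of 1 n "\<lambda>_. 1" ini p E] mc_expect_1[of ini p "\<lambda>G. mpow p (n - 1) G E"]
    stationary_dist_mpow[OF assms(1)] assms by simp

text \<open>Conditioning on the past up to the first letter of block \<open>i\<close>: being marked
  then means standing at \<open>A\<close> and reaching \<open>B\<close> in two steps, and the second
  event contributes a constant factor.\<close>

lemma mc_expect_block:
  assumes st: "stochastic_matrix p" and i: "1 \<le> i" "3 * i \<le> n"
    and f: "\<And>z z'. (\<And>l. l \<in> {1..3 * i - 2} \<Longrightarrow> z l = z' l) \<Longrightarrow> f z = f z'"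
  shows "mc_expect ini p n (\<lambda>z. f z * of_bool (nblk A B z i))
       = mpow p 2 A B * mc_expect ini p (3 * i - 2) (\<lambda>z. f z * of_bool (z (3 * i - 2) = A))"
proof -
  let ?k = "3 * i - 2"
  have "mc_expect ini p n (\<lambda>z. f z * of_bool (nblk A B z i))
      = mc_expect ini p (3 * i) (\<lambda>z. f z * of_bool (nblk A B z i))"
  proof (rule mc_expect_prefix[OF st])
    fix z z' :: "nat \<Rightarrow> 'a" assume "\<And>l. l \<in> {1..3 * i} \<Longrightarrow> z l = z' l"
    then have "f z = f z'" "z (3 * i - 2) = z' (3 * i - 2)" "z (3 * i) = z' (3 * i)"
      using i by (auto intro!: f)
    then show "f z * of_bool (nblk A B z i) = f z' * of_bool (nblk A B z' i)"
      by (simp add: nblk_def)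
  qed (use i in auto)
  also have "\<dots> = mc_expect ini p (3 * i) (\<lambda>z. (f z * of_bool (z ?k = A)) * of_bool (z (3 * i) = B))"
    by (intro mc_expect_cong) (simp add: nblk_def)
  also have "\<dots> = mc_expect ini p ?k (\<lambda>z. (f z * of_bool (z ?k = A)) * mpow p (3 * i - ?k) (z ?k) B)"
  proof (rule mc_expect_markov)
    fix z z' :: "nat \<Rightarrow> 'a" assume "\<And>l. l \<in> {1..?k} \<Longrightarrow> z l = z' l"
    then show "f z * of_bool (z ?k = A) = f z' * of_bool (z' ?k = A)"
      using i f[of z z'] by auto
  qed (use i in auto)
  also have "3 * i - ?k = 2" using i by auto
  also have "mc_expect ini p ?k (\<lambda>z. (f z * of_bool (z ?k = A)) * mpow p 2 (z ?k) B)
      = mc_expect ini p ?k (\<lambda>z. mpow p 2 A B * (f z * of_bool (z ?k = A)))"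
    by (intro mc_expect_cong) auto
  finally show ?thesis by (simp add: mc_expect_cmult)
qed

lemma mc_expect_one_block:
  assumes "stochastic_matrix p" "stationary_dist ini p" "1 \<le> i" "3 * i \<le> n"
  shows "mc_expect ini p n (\<lambda>z. of_bool (nblk A B z i)) = ini A * mpow p 2 A B"
  using mc_expect_block[of p i n "\<lambda>_. 1" ini A B] mc_expect_state[OF assms(2), of "3 * i - 2" A] assms
  by simp

text \<open>The later block is split off first, with the indicator of the earlier one as the past
  factor. The chain then travels from \<open>B\<close> at time \<open>3 * i\<close> to
  \<open>A\<close> at time \<open>3 * j - 2\<close>, which explains the exponent
  \<open>3 * (j - i) - 2\<close>.\<close>

lemma mc_expect_two_blocks:
  assumes st: "stochastic_matrix p" and stat: "stationary_dist ini p"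
    and ij: "1 \<le> i" "i < j" "3 * j \<le> n"
  shows "mc_expect ini p n (\<lambda>z. of_bool (nblk A B z i) * of_bool (nblk A B z j))
       = ini A * mpow p 2 A B * mpow p (3 * (j - i) - 2) B A * mpow p 2 A B"
proof -
  let ?X = "\<lambda>z. of_bool (nblk A B z i) :: real" and ?k = "3 * j - 2"
  have X: "?X z = ?X z'" if "\<And>l. l \<in> {1..3 * i} \<Longrightarrow> z l = z' l" for z z'
    using that ij by (auto simp: nblk_def)
  have "mc_expect ini p n (\<lambda>z. ?X z * of_bool (nblk A B z j))
      = mpow p 2 A B * mc_expect ini p ?k (\<lambda>z. ?X z * of_bool (z ?k = A))"
    using ij by (intro mc_expect_block[OF st] X) auto
  also have "mc_expect ini p ?k (\<lambda>z. ?X z * of_bool (z ?k = A))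
      = mc_expect ini p (3 * i) (\<lambda>z. ?X z * mpow p (?k - 3 * i) (z (3 * i)) A)"
    using ij by (intro mc_expect_markov X) auto
  also have "?k - 3 * i = 3 * (j - i) - 2" by auto
  also have "mc_expect ini p (3 * i) (\<lambda>z. ?X z * mpow p (3 * (j - i) - 2) (z (3 * i)) A)
      = mc_expect ini p (3 * i) (\<lambda>z. mpow p (3 * (j - i) - 2) B A * ?X z)"
    by (intro mc_expect_cong) (auto simp: nblk_def)
  finally show ?thesis
    using mc_expect_one_block[OF st stat, of i "3 * i" A B] ij by (simp add: mc_expect_cmult)
qed

text \<open>Connects the probability in the theorem with the frequency of marked blocks; it is the
  case of a single block.\<close>

lemma mc_prob_AB:
  assumes "stochastic_matrix p" "stationary_dist ini p"
  shows "mc_prob ini p 3 (\<lambda>z. z 1 = A \<and> z 3 = B) = ini A * mpow p 2 A B"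
  using mc_expect_one_block[OF assms, of 1 3 A B] by (simp add: mc_prob_eq_expect nblk_def)

lemma mc_prob_le_1:
  assumes "stochastic_matrix p" "stationary_dist ini p" "1 \<le> n"
  shows "mc_prob ini p n P \<le> 1"
  using mc_expect_mono[OF assms(1,2), of n "\<lambda>z. of_bool (P z)" "\<lambda>_. 1"] mc_expect_const[OF assms, of 1]
  by (simp add: mc_prob_eq_expect)

lemma tendsto_mean_zero:
  fixes e :: "nat \<Rightarrow> real"
  assumes "e \<longlonglongrightarrow> 0"
  shows "(\<lambda>m. (\<Sum>d\<le>m. e d) / real m) \<longlonglongrightarrow> 0"
proof (rule LIMSEQ_I)
  fix r :: real assume r: "0 < r"
  obtain N where N: "\<And>d. d \<ge> N \<Longrightarrow> \<bar>e d\<bar> < r / 2"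
    using LIMSEQ_D[OF assms, of "r / 2"] r by auto
  \<comment> \<open>The extra \<open>r\<close> absorbs the off-by-one: the sum runs over
    \<open>m + 1\<close> indices but is divided by \<open>m\<close>.\<close>
  define C where "C = (\<Sum>d<N. \<bar>e d\<bar>) + r"
  have "(\<lambda>m. C / real m) \<longlonglongrightarrow> 0" by real_asymp
  then obtain M where M: "\<And>m. m \<ge> M \<Longrightarrow> \<bar>C / real m\<bar> < r / 2"
    using LIMSEQ_D[of "\<lambda>m. C / real m" 0 "r / 2"] r by fastforce
  have "norm ((\<Sum>d\<le>m. e d) / real m - 0) < r" if m: "m \<ge> max 1 (max M N)" for m
  proof -
    have "\<bar>\<Sum>d\<le>m. e d\<bar> \<le> (\<Sum>d\<le>m. \<bar>e d\<bar>)" by (rule sum_abs)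
    also have "\<dots> = (\<Sum>d\<in>{..<N} \<union> {N..m}. \<bar>e d\<bar>)"
      using m by (intro sum.cong) auto
    also have "\<dots> = (\<Sum>d<N. \<bar>e d\<bar>) + (\<Sum>d\<in>{N..m}. \<bar>e d\<bar>)"
      by (intro sum.union_disjoint) auto
    also have "(\<Sum>d\<in>{N..m}. \<bar>e d\<bar>) \<le> (\<Sum>d\<in>{N..m}. r / 2)"
      using N by (intro sum_mono less_imp_le) auto
    also have "\<dots> \<le> (real m + 1) * (r / 2)"
      using r m by (simp add: divide_simps mult_right_mono)
    finally have "\<bar>\<Sum>d\<le>m. e d\<bar> \<le> C + real m * (r / 2)"
      using r by (simp add: C_def field_simps)
    then have "\<bar>\<Sum>d\<le>m. e d\<bar> / real m \<le> C / real m + r / 2"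
      using m by (simp add: field_simps)
    moreover have "\<bar>C / real m\<bar> < r / 2" using m by (intro M) simp
    then have "C / real m < r / 2" by (simp only: abs_less_iff)
    ultimately have "\<bar>\<Sum>d\<le>m. e d\<bar> / real m < r" by linarith
    then show ?thesis by simp
  qed
  then show "\<exists>no. \<forall>m\<ge>no. norm ((\<Sum>d\<le>m. e d) / real m - 0) < r" by blast
qed

text \<open>The square expands into covariances of block indicators. At distance
  \<open>d \<ge> 1\<close> such a covariance is at most the deviation of a matrix power from
  \<open>ini A\<close>; at distance 0 the variance of an indicator is at most 1, whence
  \<open>e 0 = 1\<close>.\<close>

lemma vcnt_variance:
  assumes st: "stochastic_matrix p" and stat: "stationary_dist ini p" and n: "3 \<le> n"
    and e0: "e 0 = 1" and e: "\<And>d. 1 \<le> d \<Longrightarrow> e d = \<bar>mpow p (3 * d - 2) B A - ini A\<bar>"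
  shows "mc_expect ini p n (\<lambda>z. (real (vcnt A B n z) - real (n div 3) * (ini A * mpow p 2 A B))\<^sup>2)
     \<le> real (n div 3) * (2 * (\<Sum>d\<le>n div 3. e d))"
proof -
  define m where "m = n div 3"
  define h where "h = mpow p 2 A B"
  define \<beta> where "\<beta> = ini A * h"
  define X where "X i z = (of_bool (nblk A B z i) :: real)" for i z
  have h: "0 \<le> h" "h \<le> 1"
  proof -
    have "h \<le> (\<Sum>F\<in>UNIV. mpow p 2 A F)"
      unfolding h_def using mpow_stochastic[OF st, of 2]
      by (intro member_le_sum) (auto simp: stochastic_matrix_def simp del: mpow.simps)
    then show "0 \<le> h" "h \<le> 1"
      using mpow_stochastic[OF st, of 2] by (auto simp: stochastic_matrix_def h_def)
  qed
  have iA: "0 \<le> ini A" "ini A \<le> 1"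
  proof -
    have "ini A \<le> (\<Sum>F\<in>UNIV. ini F)"
      using stat by (intro member_le_sum) (auto simp: stationary_dist_def)
    then show "0 \<le> ini A" "ini A \<le> 1" using stat by (auto simp: stationary_dist_def)
  qed
  have \<beta>: "0 \<le> \<beta>" "\<beta> \<le> 1" using h iA by (auto simp: \<beta>_def mult_le_one)
  have e_nn: "0 \<le> e d" for d using e0 e[of d] by (cases d) auto
  have EX: "mc_expect ini p n (X i) = \<beta>" if "i \<in> {1..m}" for i
    unfolding X_def \<beta>_def h_def using that
    by (intro mc_expect_one_block[OF st stat]) (auto simp: m_def)
  have cov: "mc_expect ini p n (\<lambda>z. (X i z - \<beta>) * (X j z - \<beta>)) \<le> e (j - i)"
    if ij: "i \<in> {1..m}" "j \<in> {1..m}" "i \<le> j" for i j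
  proof -
    have "mc_expect ini p n (\<lambda>z. (X i z - \<beta>) * (X j z - \<beta>))
        = mc_expect ini p n (\<lambda>z. X i z * X j z + (- \<beta>) * X i z + (- \<beta>) * X j z + \<beta>\<^sup>2)"
      by (intro mc_expect_cong) (simp add: algebra_simps power2_eq_square)
    also have "\<dots> = mc_expect ini p n (\<lambda>z. X i z * X j z) - \<beta>\<^sup>2"
      unfolding mc_expect_add mc_expect_cmult
      using EX ij n mc_expect_const[OF st stat, of n "\<beta>\<^sup>2"] by (simp add: power2_eq_square)
    also have "\<dots> \<le> e (j - i)"
    proof (cases "i = j")
      case True
      then have "mc_expect ini p n (\<lambda>z. X i z * X j z) = mc_expect ini p n (X i)"
        by (intro mc_expect_cong) (auto simp: X_def)
      moreover have "\<beta> - \<beta>\<^sup>2 \<le> 1" using \<beta> zero_le_power2[of \<beta>] by linarith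
      ultimately show ?thesis using True e0 EX[OF ij(1)] by simp
    next
      case False
      let ?g = "mpow p (3 * (j - i) - 2) B A"
      have "mc_expect ini p n (\<lambda>z. X i z * X j z) = \<beta> * ?g * h"
        unfolding X_def \<beta>_def h_def using ij False
        by (intro mc_expect_two_blocks[OF st stat]) (auto simp: m_def)
      then have "mc_expect ini p n (\<lambda>z. X i z * X j z) - \<beta>\<^sup>2 = (\<beta> * h) * (?g - ini A)"
        by (simp add: \<beta>_def power2_eq_square algebra_simps)
      also have "\<dots> \<le> (\<beta> * h) * e (j - i)"
        using e[of "j - i"] ij False \<beta> h by (intro mult_left_mono) auto
      also have "\<dots> \<le> e (j - i)"
        using \<beta> h e_nn by (intro mult_left_le_one_le) (auto intro: mult_le_one)
      finally show ?thesis .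
    qed
    finally show ?thesis .
  qed
  \<comment> \<open>With truncated subtraction, \<open>(j - i) + (i - j)\<close> is the distance of
    \<open>i\<close> and \<open>j\<close>.\<close>
  have cov': "mc_expect ini p n (\<lambda>z. (X i z - \<beta>) * (X j z - \<beta>)) \<le> e ((j - i) + (i - j))"
    if ij: "i \<in> {1..m}" "j \<in> {1..m}" for i j
  proof (cases "i \<le> j")
    case True
    then show ?thesis using cov[of i j] ij by simp
  next
    case False
    then have "mc_expect ini p n (\<lambda>z. (X j z - \<beta>) * (X i z - \<beta>)) \<le> e (i - j)"
      using cov[of j i] ij by simp
    then show ?thesis using False by (simp add: mult.commute)
  qed
  \<comment> \<open>On each side of \<open>i\<close> every distance occurs at most once, which gives
    the factor 2.\<close>
  have row: "(\<Sum>j\<in>{1..m}. e ((j - i) + (i - j))) \<le> 2 * (\<Sum>d\<le>m. e d)" if i: "i \<in> {1..m}" for i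
  proof -
    have part: "(\<Sum>j\<in>J. e ((j - i) + (i - j))) \<le> (\<Sum>d\<le>m. e d)"
      if "inj_on (\<lambda>j. (j - i) + (i - j)) J" "J \<subseteq> {1..m}" for J
    proof -
      have "(\<Sum>j\<in>J. e ((j - i) + (i - j))) = sum e ((\<lambda>j. (j - i) + (i - j)) ` J)"
        using sum.reindex[OF that(1), of e] by (simp add: o_def)
      also have "\<dots> \<le> (\<Sum>d\<le>m. e d)"
        using that(2) i e_nn by (intro sum_mono2) fastforce+
      finally show ?thesis .
    qed
    have "{1..m} = {1..i} \<union> {Suc i..m}" using i by auto
    then have "(\<Sum>j\<in>{1..m}. e ((j - i) + (i - j)))
        = (\<Sum>j\<in>{1..i}. e ((j - i) + (i - j))) + (\<Sum>j\<in>{Suc i..m}. e ((j - i) + (i - j)))"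
      by (simp only:) (intro sum.union_disjoint, auto)
    moreover have "(\<Sum>j\<in>{1..i}. e ((j - i) + (i - j))) \<le> (\<Sum>d\<le>m. e d)"
      using i by (intro part) (auto intro!: inj_onI)
    moreover have "(\<Sum>j\<in>{Suc i..m}. e ((j - i) + (i - j))) \<le> (\<Sum>d\<le>m. e d)"
      using i by (intro part) (auto intro!: inj_onI)
    ultimately show ?thesis by simp
  qed
  have "real (vcnt A B n z) = (\<Sum>i\<in>{1..m}. X i z)" for z
  proof -
    have "{1..m} \<inter> {i. nblk A B z i} = {i \<in> {1..n div 3}. nblk A B z i}" by (auto simp: m_def)
    then show ?thesis by (simp add: vcnt_def X_def)
  qed
  then have "mc_expect ini p n (\<lambda>z. (real (vcnt A B n z) - real m * \<beta>)\<^sup>2)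
      = mc_expect ini p n (\<lambda>z. \<Sum>i\<in>{1..m}. \<Sum>j\<in>{1..m}. (X i z - \<beta>) * (X j z - \<beta>))"
    unfolding sum_product[symmetric] by (simp add: power2_eq_square sum_subtractf)
  also have "\<dots> = (\<Sum>i\<in>{1..m}. \<Sum>j\<in>{1..m}. mc_expect ini p n (\<lambda>z. (X i z - \<beta>) * (X j z - \<beta>)))"
    by (simp only: mc_expect_sum)
  also have "\<dots> \<le> (\<Sum>i\<in>{1..m}. \<Sum>j\<in>{1..m}. e ((j - i) + (i - j)))"
    by (intro sum_mono cov')
  also have "\<dots> \<le> (\<Sum>i\<in>{1..m}. 2 * (\<Sum>d\<le>m. e d))"
    by (intro sum_mono row)
  also have "\<dots> = real m * (2 * (\<Sum>d\<le>m. e d))" by simp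
  finally show ?thesis by (simp add: m_def \<beta>_def h_def)
qed

text \<open>Chebyshev's inequality. The mean is about \<open>\<beta> * real n / 3\<close>, twice the
  threshold, and the variance is of smaller order than the square of \<open>n\<close> because the
  covariance bounds tend to 0, hence so do their averages.\<close>

lemma vcnt_lower_tail:
  fixes p :: "'e::finite \<Rightarrow> 'e \<Rightarrow> real"
  assumes st: "stochastic_matrix p" and pr: "primitive_matrix p" and stat: "stationary_dist ini p"
    and \<beta>: "\<beta> = ini A * mpow p 2 A B" "0 < \<beta>"
  shows "(\<lambda>n. mc_prob ini p n (\<lambda>z. real (vcnt A B n z) < \<beta> * real n / 6)) \<longlonglongrightarrow> 0"
proof -
  define e where "e d = (if d = 0 then 1 else \<bar>mpow p (3 * d - 2) B A - ini A\<bar>)" for d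
  have sub: "filterlim (\<lambda>d. 3 * d - 2) at_top (at_top :: nat filter)"
    unfolding filterlim_at_top eventually_sequentially 
    by (intro allI, rule_tac x = "Z + 2" in exI) auto
  have "(\<lambda>d. \<bar>mpow p (3 * d - 2) B A - ini A\<bar>) \<longlonglongrightarrow> 0"
    using filterlim_compose[OF mpow_tendsto_stationary[OF st pr stat] sub]
    by (intro tendsto_rabs_zero) (simp add: LIM_zero_iff)
  then have "e \<longlonglongrightarrow> 0"
    by (rule Lim_transform_eventually) (auto simp: e_def eventually_sequentially intro!: exI[of _ 1])
  note ces = tendsto_mean_zero[OF this]
  have "filterlim (\<lambda>n. n div 3) at_top (at_top :: nat filter)"
    unfolding filterlim_at_top eventually_sequentially 
    by (intro allI, rule_tac x = "3 * Z" in exI) auto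
  \<comment> \<open>288 = 2 * 144: the factor 2 of the variance bound, and 144 from dividing by the
    square of the deviation \<open>t\<close>, which is \<open>\<beta> * real n / 12\<close>.\<close>
  note lim = tendsto_mult_right_zero[OF filterlim_compose[OF ces this], of "288 / \<beta>\<^sup>2"]
  have nn: "0 \<le> mc_prob ini p n P" for n P
    unfolding mc_prob_def by (intro sum_nonneg mc_pmf_nonneg[OF st stat])
  have bound: "mc_prob ini p n (\<lambda>z. real (vcnt A B n z) < \<beta> * real n / 6)
      \<le> 288 / \<beta>\<^sup>2 * ((\<Sum>d\<le>n div 3. e d) / real (n div 3))" if n: "n \<ge> 8" for n
  proof -
    define m where "m = n div 3"
    define t where "t = \<beta> * real n / 12"
    have m: "real n / 3 - 2 / 3 \<le> real m" "m \<ge> 1" "m \<le> n" unfolding m_def using n by linarith+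
    have t: "0 < t" using \<beta> n by (simp add: t_def)
    have far: "t \<le> real m * \<beta> - \<beta> * real n / 6"
    proof -
      \<comment> \<open>Here \<open>n \<ge> 8\<close> is used, through
        \<open>real m \<ge> (real n - 2) / 3\<close>.\<close>
      have "real n / 12 \<le> real m - real n / 6" using m n by linarith
      then have "\<beta> * (real n / 12) \<le> \<beta> * (real m - real n / 6)"
        using \<beta> by (intro mult_left_mono) auto
      then show ?thesis by (simp add: t_def algebra_simps)
    qed
    have "mc_prob ini p n (\<lambda>z. real (vcnt A B n z) < \<beta> * real n / 6)
        \<le> mc_expect ini p n (\<lambda>z. 1 / t\<^sup>2 * (real (vcnt A B n z) - real m * \<beta>)\<^sup>2)"
      unfolding mc_prob_eq_expect
    proof (rule mc_expect_mono[OF st stat])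
      fix z :: "nat \<Rightarrow> 'e"
      have "t\<^sup>2 \<le> (real (vcnt A B n z) - real m * \<beta>)\<^sup>2" if "real (vcnt A B n z) < \<beta> * real n / 6"
        using that far t by (subst power2_commute, intro power_mono) auto
      then show "of_bool (real (vcnt A B n z) < \<beta> * real n / 6)
          \<le> 1 / t\<^sup>2 * (real (vcnt A B n z) - real m * \<beta>)\<^sup>2"
        using t by (auto simp: divide_simps)
    qed
    also have "\<dots> \<le> 1 / t\<^sup>2 * (real m * (2 * (\<Sum>d\<le>m. e d)))"
      unfolding mc_expect_cmult
      using vcnt_variance[OF st stat, of n e B A] n
      by (intro mult_left_mono) (auto simp: e_def m_def \<beta>)
    also have "\<dots> = 288 / \<beta>\<^sup>2 * ((real m)\<^sup>2 / (real n)\<^sup>2 * ((\<Sum>d\<le>m. e d) / real m))"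
      using \<beta> m n by (simp add: t_def field_simps power2_eq_square)
    also have "\<dots> \<le> 288 / \<beta>\<^sup>2 * ((\<Sum>d\<le>m. e d) / real m)"
      using m by (intro mult_left_mono mult_left_le_one_le divide_nonneg_nonneg sum_nonneg)
        (auto simp: e_def divide_le_eq_1 intro: power_mono)
    finally show ?thesis by (simp add: m_def)
  qed
  show ?thesis
    by (rule Lim_null_comparison[OF _ lim])
       (use bound nn in \<open>auto simp: eventually_sequentially intro!: exI[of _ 8]\<close>)
qed

subsection \<open>Sensitivity of the score\<close>

lemma finite_alignments [simp]: "finite (alignments n)"
proof (rule finite_subset)
  let ?L = "{xs :: nat list. set xs \<subseteq> {1..n} \<and> length xs \<le> n}"
  have "length r \<le> n" if "sorted_wrt (<) r" "set r \<subseteq> {1..n}" for r :: "nat list"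
    using that card_mono[of "{1..n}" "set r"]
    by (simp add: strict_sorted_iff distinct_card)
  then show "alignments n \<subseteq> ?L \<times> ?L"
    by (auto simp: alignments_def)
  show "finite (?L \<times> ?L)"
    by (intro finite_cartesian_product finite_lists_length_le) auto
qed

text \<open>Position \<open>j\<close> is matched at most once in each of the two words, so at most
  two summands change, each by at most \<open>M\<close> because \<open>S\<close> takes values
  between 0 and \<open>M\<close>. The gap term does not depend on \<open>z\<close>.\<close>

lemma align_score_update:
  assumes S: "\<And>x y. 0 \<le> S x y" "\<And>x y. S x y \<le> M" and rt: "rt \<in> alignments n"
  shows "\<bar>align_score S \<delta> n (z(j := D)) rt - align_score S \<delta> n z rt\<bar> \<le> 2 * M"
proof -
  obtain r t where rt': "rt = (r, t)" by (cases rt)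
  define I where "I = {i. i < length r \<and> (r ! i = j \<or> t ! i = j)}"
  define c where "c w i = S (fst (w (r ! i))) (snd (w (t ! i)))" for w i
  have M: "0 \<le> M" using order_trans[OF S] .
  have "distinct r" "distinct t" and len: "length r = length t"
    using rt by (auto simp: alignments_def rt' strict_sorted_iff)
  then have "card {i. i < length r \<and> r ! i = j} \<le> 1" "card {i. i < length r \<and> t ! i = j} \<le> 1"
    by (auto simp: card_le_Suc0_iff_eq nth_eq_iff_index_eq)
  moreover have "I = {i. i < length r \<and> r ! i = j} \<union> {i. i < length r \<and> t ! i = j}"
    by (auto simp: I_def)
  ultimately have I: "card I \<le> 2"
    using card_Un_le[of "{i. i < length r \<and> r ! i = j}" "{i. i < length r \<and> t ! i = j}"] by simp
  have "align_score S \<delta> n (z(j := D)) rt - align_score S \<delta> n z rt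
      = (\<Sum>i<length r. c (z(j := D)) i - c z i)"
    by (simp add: align_score_def rt' c_def sum_subtractf)
  also have "\<dots> = (\<Sum>i\<in>I. c (z(j := D)) i - c z i)"
    by (rule sum.mono_neutral_right) (auto simp: I_def c_def)
  also have "\<bar>\<dots>\<bar> \<le> (\<Sum>i\<in>I. M)"
  proof (rule order_trans[OF sum_abs], rule sum_mono)
    fix i
    show "\<bar>c (z(j := D)) i - c z i\<bar> \<le> M"
      unfolding c_def using S by (smt (verit))
  qed
  also have "\<dots> \<le> 2 * M" using I M by (auto intro!: mult_right_mono)
  finally show ?thesis .
qed

lemma Max_image_diff_le:
  fixes f g :: "'b \<Rightarrow> real"
  assumes "finite X" "X \<noteq> {}" "\<And>x. x \<in> X \<Longrightarrow> \<bar>f x - g x\<bar> \<le> c"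
  shows "\<bar>Max (f ` X) - Max (g ` X)\<bar> \<le> c"
proof -
  have "Max (f ` X) \<le> Max (g ` X) + c" if bound: "\<And>x. x \<in> X \<Longrightarrow> \<bar>f x - g x\<bar> \<le> c" for f g :: "'b \<Rightarrow> real"
  proof -
    have "f x \<le> Max (g ` X) + c" if "x \<in> X" for x
    proof -
      have "g x \<le> Max (g ` X)" using assms(1) \<open>x \<in> X\<close> by (intro Max_ge) auto
      then show ?thesis using bound[OF \<open>x \<in> X\<close>] by linarith
    qed
    then show ?thesis using assms(1,2) by simp
  qed
  from this[of f g] this[of g f] assms(3) show ?thesis by (auto simp: abs_minus_commute abs_le_iff)
qed

lemma LS_update:
  assumes "\<And>x y. 0 \<le> S x y" "\<And>x y. S x y \<le> M"
  shows "\<bar>LS S \<delta> n (z(j := D)) - LS S \<delta> n z\<bar> \<le> 2 * M"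
proof -
  have "([], []) \<in> alignments n" by (simp add: alignments_def)
  then show ?thesis
    unfolding LS_def by (intro Max_image_diff_le align_score_update assms) auto
qed

text \<open>The gain averages changes of a single position. What matters is that one
  \<open>K\<close> serves all lengths and configurations: it prices the configurations on which (A1)
  gives no control.\<close>

lemma R_gain_bounded:
  fixes S :: "'a::finite \<Rightarrow> 'a \<Rightarrow> real"
  assumes S: "\<forall>x y. 0 \<le> S x y"
  obtains K where "0 \<le> K" "\<And>\<delta> A B D n z. \<bar>R_gain S \<delta> A B D n z\<bar> \<le> K"
proof -
  define M where "M = Max (range (\<lambda>(x, y). S x y))"
  have M: "S x y \<le> M" for x y
    unfolding M_def by (rule Max_ge) force+
  have "0 \<le> M" using S M order_trans by blast
  have "\<bar>R_gain S \<delta> A B D n z\<bar> \<le> 2 * M" for \<delta> A B D n z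
  proof -
    let ?C = "cands A B D n z"
    have "\<bar>\<Sum>i\<in>?C. LS S \<delta> n (z(3*i - 1 := D)) - LS S \<delta> n z\<bar> \<le> (\<Sum>i\<in>?C. 2 * M)"
      using S M by (intro order_trans[OF sum_abs] sum_mono LS_update) auto
    then show ?thesis using \<open>0 \<le> M\<close>
      by (cases "card ?C = 0") (auto simp: R_gain_def field_simps)
  qed
  then show ?thesis using \<open>0 \<le> M\<close> that[of "2 * M"] by simp
qed

subsection \<open>Binomial probabilities near the mean\<close>

text \<open>The ratio of consecutive binomial probabilities, in a division-free form that the masses
  of the cells will be shown to obey as well.\<close>

lemma Bernstein_Suc:
  assumes "u < v"
  shows "real (u + 1) * (1 - q) * Bernstein v (Suc u) q = real (v - u) * q * Bernstein v u q"
proof -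
  have "real (u + 1) * real (v choose Suc u) = real (v - u) * real (v choose u)"
    using binomial_absorb_comp[of v u] binomial_absorption[of u v]
    by (metis Suc_eq_plus1 of_nat_mult)
  moreover have "(1 - q) ^ (v - u) = (1 - q) * (1 - q) ^ (v - Suc u)"
    using assms by (metis Suc_diff_Suc power_Suc)
  ultimately have "(real (u + 1) * real (v choose Suc u)) * (q * q ^ u * ((1 - q) * (1 - q) ^ (v - Suc u)))
      = (real (v - u) * real (v choose u)) * (q * q ^ u * (1 - q) ^ (v - u))"
    by simp
  then show ?thesis unfolding Bernstein_def power_Suc by (simp only: mult_ac)
qed

lemma Bernstein_flip:
  assumes "u \<le> v"
  shows "Bernstein v (v - u) (1 - q) = Bernstein v u q"
  using assms binomial_symmetric[of u v] by (simp add: Bernstein_def)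

text \<open>The square is written in terms of \<open>u * (u - 1)\<close>, \<open>u\<close> and 1,
  whose binomial means are known.\<close>

lemma Bernstein_variance:
  "(\<Sum>u\<le>v. (real u - real v * q)\<^sup>2 * Bernstein v u q) = real v * q * (1 - q)"
proof -
  have "(real u - real v * q)\<^sup>2 * Bernstein v u q =
      real u * (real u - 1) * Bernstein v u q + (1 - 2 * real v * q) * (real u * Bernstein v u q)
        + (real v * q)\<^sup>2 * Bernstein v u q" for u
    by (simp add: algebra_simps power2_eq_square)
  then show ?thesis
    by (simp add: sum.distrib flip: sum_distrib_left) (simp add: algebra_simps power2_eq_square)
qed

text \<open>Pigeonhole: since \<open>q * (1 - q) \<le> 1 / 4\<close>, Chebyshev's inequality leaves
  mass at least 3/4 within \<open>sqrt v\<close> of the mean, and at most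
  \<open>2 * sqrt v + 1\<close> integers lie there.\<close>

lemma Bernstein_large_value:
  assumes q: "0 < q" "q < 1" and v: "1 \<le> v"
  obtains u where "u \<le> v" "\<bar>real u - real v * q\<bar> \<le> sqrt (real v)"
    "3 / (4 * (2 * sqrt (real v) + 1)) \<le> Bernstein v u q"
proof -
  define N where "N = {u. u \<le> v \<and> \<bar>real u - real v * q\<bar> \<le> sqrt (real v)}"
  define B where "B = 3 / (4 * (2 * sqrt (real v) + 1))"
  have B0: "0 < B" unfolding B_def by (intro divide_pos_pos) (auto intro: add_nonneg_pos)
  have finN: "finite N" by (auto simp: N_def)
  have cheb: "3 / 4 \<le> (\<Sum>u\<in>N. Bernstein v u q)"
  proof -
    have "(\<Sum>u\<in>{..v} - N. Bernstein v u q)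
        \<le> (\<Sum>u\<in>{..v} - N. (real u - real v * q)\<^sup>2 * Bernstein v u q / real v)"
    proof (rule sum_mono)
      fix u assume "u \<in> {..v} - N"
      then have "sqrt (real v) \<le> \<bar>real u - real v * q\<bar>" by (auto simp: N_def)
      then have "real v \<le> (real u - real v * q)\<^sup>2"
        using real_sqrt_le_iff[of "real v" "(real u - real v * q)\<^sup>2"] by simp
      then have "1 * Bernstein v u q \<le> (real u - real v * q)\<^sup>2 / real v * Bernstein v u q"
        using q v by (intro mult_right_mono Bernstein_nonneg) auto
      then show "Bernstein v u q \<le> (real u - real v * q)\<^sup>2 * Bernstein v u q / real v" by simp
    qed
    also have "\<dots> \<le> (\<Sum>u\<le>v. (real u - real v * q)\<^sup>2 * Bernstein v u q / real v)"
      using q by (intro sum_mono2) (auto simp: Bernstein_nonneg)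
    also have "\<dots> = q * (1 - q)"
      using v by (simp add: Bernstein_variance flip: sum_divide_distrib)
    also have "\<dots> \<le> 1 / 4"
      using zero_le_power2[of "q - 1 / 2"] by (simp add: power2_eq_square algebra_simps)
    finally have "(\<Sum>u\<in>{..v} - N. Bernstein v u q) \<le> 1 / 4" .
    moreover have "(\<Sum>u\<le>v. Bernstein v u q)
        = (\<Sum>u\<in>{..v} - N. Bernstein v u q) + (\<Sum>u\<in>N. Bernstein v u q)"
      by (rule sum.subset_diff) (auto simp: N_def)
    ultimately show ?thesis using sum_Bernstein[of v q] by linarith
  qed
  have cardN: "real (card N) \<le> 2 * sqrt (real v) + 1"
  proof -
    define a where "a = real v * q - sqrt (real v)"
    define b where "b = real v * q + sqrt (real v)"
    have "N \<subseteq> nat ` {\<lceil>a\<rceil>..\<lfloor>b\<rfloor>}"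
    proof
      fix u assume "u \<in> N"
      then have "a \<le> real u" "real u \<le> b" by (auto simp: N_def a_def b_def abs_le_iff)
      then have "int u \<in> {\<lceil>a\<rceil>..\<lfloor>b\<rfloor>}" by (auto simp: ceiling_le_iff le_floor_iff)
      then show "u \<in> nat ` {\<lceil>a\<rceil>..\<lfloor>b\<rfloor>}" by (metis image_eqI nat_int)
    qed
    then have "card N \<le> card {\<lceil>a\<rceil>..\<lfloor>b\<rfloor>}"
      by (meson card_image_le card_mono finite_atLeastAtMost_int finite_imageI order_trans)
    then have "int (card N) \<le> max 0 (\<lfloor>b\<rfloor> - \<lceil>a\<rceil> + 1)" by auto
    moreover have "real_of_int (\<lfloor>b\<rfloor> - \<lceil>a\<rceil> + 1) \<le> 2 * sqrt (real v) + 1"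
      unfolding a_def b_def by linarith
    moreover have "0 \<le> 2 * sqrt (real v) + 1" by (simp add: add_nonneg_nonneg)
    ultimately show ?thesis by linarith
  qed
  have "\<exists>u\<in>N. B \<le> Bernstein v u q"
  proof (rule ccontr)
    assume "\<not> ?thesis"
    then have less: "Bernstein v u q < B" if "u \<in> N" for u using that by force
    have "N \<noteq> {}" using cheb by auto
    then have "(\<Sum>u\<in>N. Bernstein v u q) < (\<Sum>u\<in>N. B)"
      using finN less by (intro sum_strict_mono) auto
    also have "\<dots> \<le> (2 * sqrt (real v) + 1) * B"
      using cardN B0 by (simp add: mult_right_mono)
    also have "\<dots> = 3 / 4"
    proof -
      have "2 * sqrt (real v) + 1 \<noteq> 0"
        using real_sqrt_ge_zero[of "real v"] by linarith
      then show ?thesis unfolding B_def by (simp add: divide_simps)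
    qed
    finally show False using cheb by simp
  qed
  then show ?thesis using that by (auto simp: N_def B_def)
qed

text \<open>Walking from \<^term>\<open>u1\<close> up to \<^term>\<open>u0\<close>, each ratio of consecutive values is at least the
  last one, because these ratios decrease.\<close>

lemma Bernstein_walk_up:
  assumes q: "0 < q" "q < 1" and u: "u1 \<le> u0" "u0 \<le> v" and \<rho>: "0 \<le> \<rho>"
    and last: "\<rho> * (real u0 * (1 - q)) \<le> real (v - u0) * q"
  shows "\<rho> ^ (u0 - u1) * Bernstein v u1 q \<le> Bernstein v u0 q"
proof -
  have "\<rho> ^ (u - u1) * Bernstein v u1 q \<le> Bernstein v u q" if "u1 \<le> u" "u \<le> u0" for u
    using that
  proof (induction u rule: dec_induct)
    case (step u)
    have "\<rho> ^ (Suc u - u1) * Bernstein v u1 q = \<rho> * (\<rho> ^ (u - u1) * Bernstein v u1 q)"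
      using step by (simp add: Suc_diff_le)
    also have "\<dots> \<le> \<rho> * Bernstein v u q"
      using step \<rho> by (intro mult_left_mono) auto
    finally have 1: "\<rho> ^ (Suc u - u1) * Bernstein v u1 q \<le> \<rho> * Bernstein v u q" .
    let ?c = "real (u + 1) * (1 - q)"
    have "\<rho> * ?c \<le> \<rho> * (real u0 * (1 - q))"
      using step q \<rho> by (intro mult_left_mono mult_right_mono) auto
    also have "\<dots> \<le> real (v - u) * q"
      using last step q by (elim order_trans) (auto intro!: mult_right_mono)
    finally have "\<rho> * ?c * Bernstein v u q \<le> real (v - u) * q * Bernstein v u q"
      using q by (intro mult_right_mono Bernstein_nonneg) auto
    also have "\<dots> = ?c * Bernstein v (Suc u) q"
      using Bernstein_Suc[of u v q] step u by simp
    finally have "?c * (\<rho> * Bernstein v u q) \<le> ?c * Bernstein v (Suc u) q"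
      by (simp only: mult_ac)
    moreover have "0 < ?c" using q by (intro mult_pos_pos) auto
    ultimately have "\<rho> * Bernstein v u q \<le> Bernstein v (Suc u) q"
      by (rule mult_left_le_imp_le)
    then show ?case using 1 by linarith
  qed simp
  then show ?thesis using u by simp
qed

text \<open>The walk from \<open>u1\<close> to \<open>u0\<close> has at most
  \<open>sqrt v + sqrt v / 4\<close> steps, whence the exponent. The base is the ratio of
  consecutive values estimated at \<open>u0\<close>, the worst place, with \<open>u0\<close>
  replaced by its largest value \<open>v * q + sqrt v / 4\<close>. The lower bound on
  \<open>sqrt v\<close> in terms of \<open>q\<close> keeps the base nonnegative.\<close>

lemma Bernstein_compare_up:
  assumes q: "0 < q" "q < 1" and u: "u1 \<le> u0" "u0 \<le> v"
    and v: "1 \<le> v" "1 / (4 * (1 - q)) \<le> sqrt (real v)"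
    and u0: "\<bar>real u0 - real v * q\<bar> \<le> sqrt (real v) / 4"
    and u1: "\<bar>real u1 - real v * q\<bar> \<le> sqrt (real v)"
  shows "((1 - 1 / (4 * (1 - q)) / sqrt (real v)) / (1 + 1 / (4 * q) / sqrt (real v)))
            powr (5 / 4 * sqrt (real v)) * Bernstein v u1 q \<le> Bernstein v u0 q"
proof -
  define x where "x = sqrt (real v)"
  have x: "1 \<le> x" "real v = x * x" using v by (auto simp: x_def)
  define \<rho> where "\<rho> = (1 - 1 / (4 * (1 - q)) / x) / (1 + 1 / (4 * q) / x)"
  have num: "0 \<le> 1 - 1 / (4 * (1 - q)) / x"
  proof -
    have "1 / (4 * (1 - q)) / x \<le> 1"
      using v(2) x(1) by (subst divide_le_eq_1_pos) (auto simp: x_def)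
    then show ?thesis by simp
  qed
  have den: "1 \<le> 1 + 1 / (4 * q) / x" using q x by simp
  have \<rho>0: "0 \<le> \<rho>" unfolding \<rho>_def using num den by (intro divide_nonneg_pos) linarith+
  have \<rho>1: "\<rho> \<le> 1" 
  proof -
    have "1 - 1 / (4 * (1 - q)) / x \<le> 1" using q x by simp
    then show ?thesis unfolding \<rho>_def using den by (subst divide_le_eq_1_pos) linarith+
  qed
  have u0': "real u0 \<le> x * x * q + x / 4" "x * x * q - x / 4 \<le> real u0"
    using u0[folded x_def, unfolded x(2)] by (simp_all only: abs_le_iff) linarith+
  have "\<rho> * (real u0 * (1 - q)) \<le> \<rho> * ((x * x * q + x / 4) * (1 - q))"
    using u0' q \<rho>0 by (intro mult_left_mono mult_right_mono) auto
  also have "\<dots> = \<rho> * (1 + 1 / (4 * q) / x) * (x * x * q * (1 - q))"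
    using q x by (simp add: field_simps)
  also have "\<rho> * (1 + 1 / (4 * q) / x) = 1 - 1 / (4 * (1 - q)) / x"
    unfolding \<rho>_def by (rule nonzero_eq_divide_eq[THEN iffD1, OF _ refl]) (use den in linarith)
  also have "\<dots> * (x * x * q * (1 - q)) = (x * x - x * x * q - x / 4) * q"
    using q x by (simp add: field_simps)
  also have "\<dots> \<le> real (v - u0) * q"
    using u0' x(2) q u by (intro mult_right_mono) (auto simp: of_nat_diff)
  finally have walk: "\<rho> ^ (u0 - u1) * Bernstein v u1 q \<le> Bernstein v u0 q"
    by (intro Bernstein_walk_up q u \<rho>0)
  have "real (u0 - u1) \<le> 5 / 4 * x"
    using u0 u1 u unfolding x_def abs_le_iff by (simp add: of_nat_diff)
  have "\<rho> powr (5 / 4 * x) \<le> \<rho> ^ (u0 - u1)"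
  proof (cases "\<rho> = 0")
    case False
    then have "\<rho> ^ (u0 - u1) = \<rho> powr real (u0 - u1)"
      using \<rho>0 by (simp add: powr_realpow)
    then show ?thesis
      using \<open>real (u0 - u1) \<le> _\<close> \<rho>0 \<rho>1 False by (simp add: powr_mono')
  qed simp
  then have "\<rho> powr (5 / 4 * x) * Bernstein v u1 q \<le> \<rho> ^ (u0 - u1) * Bernstein v u1 q"
    using q by (intro mult_right_mono Bernstein_nonneg) auto
  with walk show ?thesis by (simp add: \<rho>_def x_def)
qed

text \<open>Compare with the large value \<open>u1\<close> found by pigeonhole. As \<open>v\<close>
  grows, the comparison factor tends to an exponential. Values \<open>u\<close> below
  \<open>u1\<close> are reached by exchanging \<open>q\<close> and \<open>1 - q\<close>, which
  leaves the limit unchanged since it depends on \<open>q * (1 - q)\<close> only.\<close>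

lemma Bernstein_lower_bound:
  assumes q: "0 < q" "q < 1"
  shows "\<forall>\<^sub>F v in sequentially. \<forall>u\<le>v. \<bar>real u - real v * q\<bar> \<le> sqrt (real v) / 4 \<longrightarrow>
           exp (- (5 / (16 * (q * (1 - q))))) / 3 / sqrt (real v) \<le> Bernstein v u q"
proof -
  define E where "E = exp (- (5 / (16 * (q * (1 - q)))))"
  define g where "g a b x = ((1 - a / x) / (1 + b / x)) powr (5 / 4 * x)" for a b x :: real
  have lim: "((\<lambda>x. g a b x) \<longlongrightarrow> exp ((- (b * 5) - a * 5) / 4)) at_top" if "0 < a" "0 < b" for a b
    unfolding g_def using that by real_asymp
  have E: "exp ((- (1 / (4 * q) * 5) - 1 / (4 * (1 - q)) * 5) / 4) = E"
          "exp ((- (1 / (4 * (1 - q)) * 5) - 1 / (4 * q) * 5) / 4) = E"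
    unfolding E_def using q by (simp_all add: field_simps)
  have E0: "0 < E" by (simp add: E_def)
  have sq: "filterlim (\<lambda>v. sqrt (real v)) at_top sequentially" by real_asymp
  have ev: "\<forall>\<^sub>F x in at_top. 9 / 10 * E < g a b x"
    if "0 < a" "0 < b" "exp ((- (b * 5) - a * 5) / 4) = E" for a b
    using order_tendstoD(1)[OF lim[OF that(1,2)], of "9 / 10 * E"] that(3) E0 by simp
  have "\<forall>\<^sub>F v in sequentially. 9 / 10 * E < g (1 / (4 * (1 - q))) (1 / (4 * q)) (sqrt (real v))"
    using eventually_compose_filterlim[OF ev sq] q E by simp
  moreover have "\<forall>\<^sub>F v in sequentially. 9 / 10 * E < g (1 / (4 * q)) (1 / (4 * (1 - q))) (sqrt (real v))"
    using eventually_compose_filterlim[OF ev sq] q E by simp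
  moreover have "\<forall>\<^sub>F v in sequentially. 1 / (4 * (1 - q)) \<le> sqrt (real v)"
    using sq by (simp add: filterlim_at_top)
  moreover have "\<forall>\<^sub>F v in sequentially. 1 / (4 * q) \<le> sqrt (real v)"
    using sq by (simp add: filterlim_at_top)
  moreover have "\<forall>\<^sub>F v in sequentially. 100 \<le> sqrt (real v)"
    using sq by (simp add: filterlim_at_top)
  ultimately show ?thesis
  proof eventually_elim
    case (elim v)
    define x where "x = sqrt (real v)"
    have x: "100 \<le> x" using elim by (simp add: x_def)
    have v: "1 \<le> v" using x by (cases v) (auto simp: x_def)
    obtain u1 where u1: "u1 \<le> v" "\<bar>real u1 - real v * q\<bar> \<le> sqrt (real v)"
        "3 / (4 * (2 * sqrt (real v) + 1)) \<le> Bernstein v u1 q"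
      using Bernstein_large_value[OF q v] .
    show ?case
    proof (intro allI impI)
      fix u assume u: "u \<le> v" "\<bar>real u - real v * q\<bar> \<le> sqrt (real v) / 4"
      have *: "9 / 10 * E * Bernstein v u1 q \<le> Bernstein v u q"
      proof (cases "u1 \<le> u")
        case True
        have "9 / 10 * E * Bernstein v u1 q
            \<le> g (1 / (4 * (1 - q))) (1 / (4 * q)) (sqrt (real v)) * Bernstein v u1 q"
          using elim q by (intro mult_right_mono Bernstein_nonneg) auto
        also have "\<dots> \<le> Bernstein v u q"
          unfolding g_def using Bernstein_compare_up[OF q True u(1) v elim(3) u(2) u1(2)] .
        finally show ?thesis .
      next
        case False
        have q': "0 < 1 - q" "1 - q < 1" using q by auto
        have "9 / 10 * E * Bernstein v u1 q
            \<le> g (1 / (4 * q)) (1 / (4 * (1 - q))) (sqrt (real v)) * Bernstein v u1 q"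
          using elim q by (intro mult_right_mono Bernstein_nonneg) auto
        also have "\<dots> = g (1 / (4 * q)) (1 / (4 * (1 - q))) (sqrt (real v))
            * Bernstein v (v - u1) (1 - q)"
          using u1 by (simp add: Bernstein_flip)
        also have "\<dots> \<le> Bernstein v (v - u) (1 - q)"
        proof -
          have "\<bar>real (v - u) - real v * (1 - q)\<bar> = \<bar>real u - real v * q\<bar>"
               "\<bar>real (v - u1) - real v * (1 - q)\<bar> = \<bar>real u1 - real v * q\<bar>"
            using u u1 by (simp_all add: of_nat_diff algebra_simps abs_minus_commute)
          then show ?thesis
            unfolding g_def using Bernstein_compare_up[OF q', of "v - u1" "v - u" v] False u u1 elim v
            by simp
        qed
        also have "\<dots> = Bernstein v u q" using u by (simp add: Bernstein_flip)
        finally show ?thesis .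
      qed
      \<comment> \<open>Asymptotically the right-hand factor is 9/10 * 3/8 = 27/80, slightly above
        1/3; the excess pays for the 1 in \<open>2 * x + 1\<close> once \<open>x\<close> is
        large.\<close>
      have "E / 3 / x \<le> 9 / 10 * E * (3 / (4 * (2 * x + 1)))"
        using x E0 by (simp add: field_simps)
      also have "\<dots> \<le> 9 / 10 * E * Bernstein v u1 q"
        using u1(3) E0 by (intro mult_left_mono) (auto simp: x_def)
      finally show "exp (- (5 / (16 * (q * (1 - q))))) / 3 / sqrt (real v) \<le> Bernstein v u q"
        using * by (simp add: E_def x_def)
    qed
  qed
qed

subsection \<open>The resampling identity\<close>

definition cell :: "'e::finite \<Rightarrow> 'e \<Rightarrow> 'e \<Rightarrow> nat \<Rightarrow> nat \<Rightarrow> nat \<Rightarrow> (nat \<Rightarrow> 'e) set" where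
  "cell A B D n u v = {z \<in> seqs n. ucnt A B D n z = u \<and> vcnt A B n z = v}"

text \<open>An expectation restricted to a cell and not normalised, so that null cells need no
  convention; with \<open>f = 1\<close> it is the probability of the cell.\<close>

definition cell_sum :: "('e::finite \<Rightarrow> real) \<Rightarrow> ('e \<Rightarrow> 'e \<Rightarrow> real) \<Rightarrow> 'e \<Rightarrow> 'e \<Rightarrow> 'e
     \<Rightarrow> nat \<Rightarrow> nat \<Rightarrow> nat \<Rightarrow> ((nat \<Rightarrow> 'e) \<Rightarrow> real) \<Rightarrow> real" where
  "cell_sum ini p A B D n u v f = (\<Sum>z\<in>cell A B D n u v. mc_pmf ini p n z * f z)"

definition dpos :: "'e \<Rightarrow> 'e \<Rightarrow> 'e \<Rightarrow> nat \<Rightarrow> (nat \<Rightarrow> 'e) \<Rightarrow> nat set" where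
  "dpos A B D n z = {i\<in>{1..n div 3}. nblk A B z i \<and> z (3*i - 1) = D}"

lemma card_cands: "card (cands A B D n z) = vcnt A B n z - ucnt A B D n z"
  and ucnt_le_vcnt: "ucnt A B D n z \<le> vcnt A B n z"
proof -
  let ?V = "{i\<in>{1..n div 3}. nblk A B z i}"
  have sub: "dpos A B D n z \<subseteq> ?V" by (auto simp: dpos_def)
  have "cands A B D n z = ?V - dpos A B D n z" by (auto simp: dpos_def cands_def)
  with sub show "card (cands A B D n z) = vcnt A B n z - ucnt A B D n z"
    by (simp add: card_Diff_subset finite_subset vcnt_def ucnt_def dpos_def)
  show "ucnt A B D n z \<le> vcnt A B n z"
    using card_mono[OF _ sub] by (simp add: vcnt_def ucnt_def dpos_def)
qed

lemma vcnt_le: "vcnt A B n z \<le> n"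
proof -
  have "vcnt A B n z \<le> card {1..n div 3}"
    unfolding vcnt_def by (intro card_mono) auto
  also have "\<dots> \<le> n" by simp
  finally show ?thesis .
qed

text \<open>Marking looks at positions congruent to 1 and 0 modulo 3, the update at one congruent to
  2; indices from 1 on keep the truncated subtraction honest.\<close>

lemma nblk_update:
  assumes "1 \<le> i" "1 \<le> k"
  shows "nblk A B (z(3 * i - 1 := E)) k = nblk A B z k"
proof -
  have "3 * k - 2 \<noteq> 3 * i - 1" "3 * k \<noteq> 3 * i - 1" using assms by presburger+
  then show ?thesis by (simp add: nblk_def)
qed

lemma vcnt_update: "1 \<le> i \<Longrightarrow> vcnt A B n (z(3 * i - 1 := E)) = vcnt A B n z"
  unfolding vcnt_def by (intro arg_cong[where f = card] Collect_cong) (auto simp: nblk_update simp del: One_nat_def)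

lemma dpos_update:
  assumes "1 \<le> i"
  shows "dpos A B D n (z(3 * i - 1 := E))
       = dpos A B D n z - {i} \<union> (if E = D \<and> i \<in> {1..n div 3} \<and> nblk A B z i then {i} else {})"
proof -
  have "3 * k - 1 = 3 * i - 1 \<longleftrightarrow> k = i" if "1 \<le> k" for k using that assms by presburger
  then have upd: "(z(3 * i - 1 := E)) (3 * k - 1) = (if k = i then E else z (3 * k - 1))" if "1 \<le> k" for k
    using that by simp
  show ?thesis
  proof (rule set_eqI)
    fix k
    show "k \<in> dpos A B D n (z(3 * i - 1 := E)) \<longleftrightarrow> k \<in> dpos A B D n z - {i} \<union>
        (if E = D \<and> i \<in> {1..n div 3} \<and> nblk A B z i then {i} else {})"
    proof (cases "1 \<le> k")
      case True
      then show ?thesis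
        unfolding dpos_def mem_Collect_eq nblk_update[OF assms True] upd[OF True] by auto
    next
      case False
      then show ?thesis using assms by (auto simp: dpos_def)
    qed
  qed
qed

text \<open>This and the next lemma are the two directions of the bijection behind the resampling
  identity: fill a candidate with \<open>D\<close>, or put another letter back.\<close>

lemma update_cands:
  assumes z: "z \<in> cell A B D n u v" and i: "i \<in> cands A B D n z"
  shows "z(3 * i - 1 := D) \<in> cell A B D n (Suc u) v" "i \<in> dpos A B D n (z(3 * i - 1 := D))"
proof -
  have i': "1 \<le> i" "i \<le> n div 3" "nblk A B z i" "z (3 * i - 1) \<noteq> D"
    using i by (auto simp: cands_def)
  then have d: "dpos A B D n (z(3 * i - 1 := D)) = insert i (dpos A B D n z)" "i \<notin> dpos A B D n z"
    by (auto simp: dpos_update simp del: One_nat_def) (auto simp: dpos_def)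
  then show "i \<in> dpos A B D n (z(3 * i - 1 := D))" by simp
  have "finite (dpos A B D n z)" by (simp add: dpos_def)
  with d have "ucnt A B D n (z(3 * i - 1 := D)) = Suc (ucnt A B D n z)"
    unfolding ucnt_def dpos_def[symmetric] by simp
  moreover have "z(3 * i - 1 := D) \<in> seqs n"
    using z i' by (auto simp: cell_def seqs_def PiE_def extensional_def)
  ultimately show "z(3 * i - 1 := D) \<in> cell A B D n (Suc u) v"
    using z i' by (simp add: cell_def vcnt_update del: One_nat_def)
qed

lemma update_dpos:
  assumes z: "z \<in> cell A B D n (Suc u) v" and i: "i \<in> dpos A B D n z" and E: "E \<noteq> D"
  shows "z(3 * i - 1 := E) \<in> cell A B D n u v" "i \<in> cands A B D n (z(3 * i - 1 := E))"
proof -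
  have i': "1 \<le> i" "i \<le> n div 3" "nblk A B z i" "z (3 * i - 1) = D"
    using i by (auto simp: dpos_def)
  then show "i \<in> cands A B D n (z(3 * i - 1 := E))"
    using E by (auto simp: cands_def nblk_update simp del: One_nat_def)
  have d: "dpos A B D n (z(3 * i - 1 := E)) = dpos A B D n z - {i}"
    using E i' by (auto simp: dpos_update simp del: One_nat_def)
  have "finite (dpos A B D n z)" by (simp add: dpos_def)
  with d i have "ucnt A B D n (z(3 * i - 1 := E)) = ucnt A B D n z - 1"
    unfolding ucnt_def dpos_def[symmetric] by simp
  moreover have "z(3 * i - 1 := E) \<in> seqs n"
    using z i' by (auto simp: cell_def seqs_def PiE_def extensional_def)
  ultimately show "z(3 * i - 1 := E) \<in> cell A B D n u v"
    using z i' by (simp add: cell_def vcnt_update del: One_nat_def)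
qed

text \<open>Only the transitions into and out of the middle letter change, and both outer letters
  are known. Cross-multiplication avoids a division here.\<close>

lemma mc_pmf_update:
  assumes i: "1 \<le> i" "3 * i \<le> n" and z: "nblk A B z i" "z (3 * i - 1) = D"
  shows "mc_pmf ini p n (z(3 * i - 1 := E)) * (p A D * p D B)
       = mc_pmf ini p n z * (p A E * p E B)"
proof -
  let ?j = "3 * i - 1" let ?k = "3 * i - 2" let ?z = "z(3 * i - 1 := E)"
  define I where "I = {1..<n} - {?j, ?k}"
  define g where "g w l = p (w l) (w (Suc l))" for w l
  have "{1..<n} = insert ?k (insert ?j I)" using i by (auto simp: I_def)
  moreover have "?k \<noteq> ?j" "?k \<notin> I" "?j \<notin> I" "finite I" using i by (auto simp: I_def)
  ultimately have split: "(\<Prod>l\<in>{1..<n}. g w l) = g w ?k * (g w ?j * (\<Prod>l\<in>I. g w l))" for w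
    by simp
  have "g ?z l = g z l" if "l \<in> I" for l
    using that i by (auto simp: I_def g_def)
  then have "(\<Prod>l\<in>I. g ?z l) = (\<Prod>l\<in>I. g z l)" by (rule prod.cong[OF refl])
  \<comment> \<open>The last inequality keeps the initial factor \<open>ini (z 1)\<close>
    unchanged.\<close>
  moreover have "Suc ?k = ?j" "Suc ?j = 3 * i" "?k \<noteq> ?j" "3 * i \<noteq> ?j" "1 \<noteq> ?j" using i by auto
  ultimately show ?thesis
    using z i unfolding mc_pmf_def g_def[symmetric] split by (simp add: g_def nblk_def)
qed

text \<open>Filling a uniformly chosen candidate of a configuration with \<^term>\<open>u\<close> blocks equal to
  \<^term>\<open>D\<close> reproduces, up to a constant, the law of the configurations with \<^term>\<open>Suc u\<close> such blocks.
  This single identity yields both the binomial law of \<^term>\<open>u\<close> given \<^term>\<open>v\<close> and the drift of the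
  conditional means of the score.\<close>

lemma cell_sum_swap:
  fixes p :: "'e::finite \<Rightarrow> 'e \<Rightarrow> real"
  assumes q: "q = p A D * p D B / (\<Sum>E\<in>UNIV. p A E * p E B)" and q0: "0 < q"
  shows "cell_sum ini p A B D n u v (\<lambda>z. \<Sum>i\<in>cands A B D n z. f (z(3 * i - 1 := D)))
       = (1 - q) / q * real (u + 1) * cell_sum ini p A B D n (Suc u) v f"
proof -
  let ?w = "mc_pmf ini p n" and ?T = "\<Sum>E\<in>UNIV. p A E * p E B"
  have PT: "p A D * p D B \<noteq> 0" "?T \<noteq> 0" using q q0 by auto
  have finc: "finite (cell A B D n u v)" for u v by (simp add: cell_def)
  have "cell_sum ini p A B D n u v (\<lambda>z. \<Sum>i\<in>cands A B D n z. f (z(3 * i - 1 := D)))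
      = (\<Sum>(z, i)\<in>Sigma (cell A B D n u v) (cands A B D n). ?w z * f (z(3 * i - 1 := D)))"
    unfolding cell_sum_def sum_distrib_left
    by (subst sum.Sigma) (auto simp: finc cands_def)
  also have "\<dots> = (\<Sum>(z, i, E)\<in>(SIGMA z:cell A B D n (Suc u) v. dpos A B D n z \<times> (UNIV - {D})).
                    ?w z * f z * ((p A E * p E B) / (p A D * p D B)))"
  \<comment> \<open>Pairs of a configuration and a candidate correspond to triples of the filled
    configuration, one of its \<open>D\<close> blocks and the overwritten letter; remembering that
    letter makes the filling invertible.\<close>
  proof (rule sum.reindex_bij_witness[where i = "\<lambda>(z, i, E). (z(3 * i - 1 := E), i)"
        and j = "\<lambda>(z, i). (z(3 * i - 1 := D), i, z (3 * i - 1))"], goal_cases)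
    case (1 a)
    then show ?case by auto
  next
    case (2 a)
    then show ?case by (auto dest: update_cands simp: cands_def)
  next
    case (3 b)
    then show ?case by (auto simp: dpos_def)
  next
    case (4 b)
    then show ?case by (auto dest: update_dpos)
  next
    case (5 a)
    obtain z i where a: "a = (z, i)" "z \<in> cell A B D n u v" "i \<in> cands A B D n z" using 5 by auto
    let ?z = "z(3 * i - 1 := D)"
    have "1 \<le> i" "3 * i \<le> n" "nblk A B ?z i"
      using a by (auto simp: cands_def nblk_update simp del: One_nat_def)
    from mc_pmf_update[OF this, of D ini p "z (3 * i - 1)"]
    have "?w z * (p A D * p D B) = ?w ?z * (p A (z (3 * i - 1)) * p (z (3 * i - 1)) B)" by simp
    then have "?w z = ?w ?z * (p A (z (3 * i - 1)) * p (z (3 * i - 1)) B) / (p A D * p D B)"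
      using PT by (simp add: field_simps)
    then show ?case by (simp add: a)
  qed
  also have "\<dots> = (\<Sum>z\<in>cell A B D n (Suc u) v. \<Sum>i\<in>dpos A B D n z. \<Sum>E\<in>UNIV - {D}.
                    ?w z * f z * ((p A E * p E B) / (p A D * p D B)))"
    unfolding sum.cartesian_product by (rule sum.Sigma[symmetric]) (auto simp: finc dpos_def)
  also have "\<dots> = (\<Sum>z\<in>cell A B D n (Suc u) v. real (u + 1) * (?w z * f z * ((1 - q) / q)))"
  proof (rule sum.cong[OF refl])
    fix z assume "z \<in> cell A B D n (Suc u) v"
    then have card: "card (dpos A B D n z) = u + 1" by (simp add: cell_def ucnt_def dpos_def)
    \<comment> \<open>Among all middle letters \<open>D\<close> has share \<open>q\<close>, so the
      overwritten ones have total weight \<open>1 - q\<close> relative to it.\<close>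
    have "(\<Sum>E\<in>UNIV - {D}. (p A E * p E B) / (p A D * p D B)) = (?T - p A D * p D B) / (p A D * p D B)"
      by (simp add: sum_diff1 flip: sum_divide_distrib)
    also have "\<dots> = (1 - q) / q" using PT by (simp add: q field_simps)
    finally show "(\<Sum>i\<in>dpos A B D n z. \<Sum>E\<in>UNIV - {D}. ?w z * f z * ((p A E * p E B) / (p A D * p D B)))
        = real (u + 1) * (?w z * f z * ((1 - q) / q))"
      unfolding sum_distrib_left[symmetric] using card by simp
  qed
  finally show ?thesis by (simp add: cell_sum_def sum_distrib_left mult_ac)
qed

subsection \<open>Conditional means of the score\<close>

lemma mc_expect_cells:
  fixes f :: "(nat \<Rightarrow> 'e::finite) \<Rightarrow> real"
  shows "mc_expect ini p n f = (\<Sum>v\<le>n. \<Sum>u\<le>v. cell_sum ini p A B D n u v f)"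
proof -
  let ?g = "\<lambda>z. (vcnt A B n z, ucnt A B D n z)"
  have "mc_expect ini p n f
      = (\<Sum>y\<in>(SIGMA v:{..n}. {..v}). \<Sum>z\<in>{z \<in> seqs n. ?g z = y}. mc_pmf ini p n z * f z)"
    unfolding mc_expect_def by (rule sum.group[symmetric]) (auto simp: vcnt_le ucnt_le_vcnt)
  also have "\<dots> = (\<Sum>(v, u)\<in>(SIGMA v:{..n}. {..v}). cell_sum ini p A B D n u v f)"
    by (intro sum.cong refl) (auto simp: cell_sum_def cell_def conj_commute intro!: sum.cong)
  also have "\<dots> = (\<Sum>v\<le>n. \<Sum>u\<le>v. cell_sum ini p A B D n u v f)"
    by (rule sum.Sigma[symmetric]) auto
  finally show ?thesis .
qed

lemma cell_sum_add:
  "cell_sum ini p A B D n u v (\<lambda>z. f z + g z) = cell_sum ini p A B D n u v f + cell_sum ini p A B D n u v g"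
  by (simp add: cell_sum_def distrib_left sum.distrib)

lemma cell_sum_cmult: "cell_sum ini p A B D n u v (\<lambda>z. c * f z) = c * cell_sum ini p A B D n u v f"
  by (simp add: cell_sum_def sum_distrib_left mult_ac)

lemma cell_sum_cong:
  "(\<And>z. z \<in> cell A B D n u v \<Longrightarrow> f z = g z) \<Longrightarrow>
     cell_sum ini p A B D n u v f = cell_sum ini p A B D n u v g"
  unfolding cell_sum_def by (intro sum.cong) auto

lemma cell_sum_mono:
  assumes "stochastic_matrix p" "stationary_dist ini p" "\<And>z. f z \<le> g z"
  shows "cell_sum ini p A B D n u v f \<le> cell_sum ini p A B D n u v g"
  unfolding cell_sum_def using assms by (intro sum_mono mult_left_mono mc_pmf_nonneg) auto

lemma cell_sum_nonneg:
  assumes "stochastic_matrix p" "stationary_dist ini p" "\<And>z. 0 \<le> f z"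
  shows "0 \<le> cell_sum ini p A B D n u v f"
  unfolding cell_sum_def using assms by (intro sum_nonneg mult_nonneg_nonneg mc_pmf_nonneg) auto

text \<open>Dividing by its positive mass makes the cell a probability space. The triangle
  inequality and monotonicity bring the absolute value inside the average, and convexity then brings
  \<open>\<Phi>\<close> inside.\<close>

lemma cell_sum_jensen:
  fixes \<Phi> :: "real \<Rightarrow> real"
  assumes st: "stochastic_matrix p" and stat: "stationary_dist ini p"
    and \<Phi>: "convex_on {0..} \<Phi>" "mono_on {0..} \<Phi>"
    and W: "0 < cell_sum ini p A B D n u v (\<lambda>_. 1)"
  shows "cell_sum ini p A B D n u v (\<lambda>_. 1)
            * \<Phi> \<bar>cell_sum ini p A B D n u v f / cell_sum ini p A B D n u v (\<lambda>_. 1) - m\<bar>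
       \<le> cell_sum ini p A B D n u v (\<lambda>z. \<Phi> \<bar>f z - m\<bar>)"
proof -
  define C where "C = cell A B D n u v"
  define W where "W = cell_sum ini p A B D n u v (\<lambda>_. 1)"
  define a where "a z = mc_pmf ini p n z / W" for z
  have W0: "0 < W" using W by (simp add: W_def)
  have cs: "cell_sum ini p A B D n u v g = W * (\<Sum>z\<in>C. a z * g z)" for g
    using W0 by (simp add: cell_sum_def C_def a_def sum_distrib_left)
  have a1: "(\<Sum>z\<in>C. a z) = 1" using cs[of "\<lambda>_. 1"] W0 by (simp add: W_def[symmetric])
  have a0: "0 \<le> a z" for z unfolding a_def using mc_pmf_nonneg[OF st stat] W0 by simp
  have finC: "finite C" by (simp add: C_def cell_def)
  have "\<bar>cell_sum ini p A B D n u v f / W - m\<bar> = \<bar>\<Sum>z\<in>C. a z * (f z - m)\<bar>"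
    using W0 a1 by (simp add: cs right_diff_distrib sum_subtractf flip: sum_distrib_right)
  also have "\<dots> \<le> (\<Sum>z\<in>C. a z * \<bar>f z - m\<bar>)"
    using a0 by (intro order_trans[OF sum_abs]) (simp add: abs_mult)
  finally have "\<Phi> \<bar>cell_sum ini p A B D n u v f / W - m\<bar> \<le> \<Phi> (\<Sum>z\<in>C. a z * \<bar>f z - m\<bar>)"
    using a0 by (intro mono_onD[OF \<Phi>(2)]) (auto intro!: sum_nonneg)
  also have "\<dots> \<le> (\<Sum>z\<in>C. a z * \<Phi> \<bar>f z - m\<bar>)"
  proof -
    have "C \<noteq> {}" using a1 by auto
    then show ?thesis
      using convex_on_sum[OF finC _ \<Phi>(1), of a "\<lambda>z. \<bar>f z - m\<bar>"] a0 a1 by simp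
  qed
  finally show ?thesis using W0 by (simp add: cs[of "\<lambda>z. \<Phi> \<bar>f z - m\<bar>"] flip: W_def)
qed

text \<open>The resampling identity for the constant function 1, as every configuration of the cell
  has \<open>v - u\<close> candidates.\<close>

lemma cell_mass_Suc:
  fixes p :: "'e::finite \<Rightarrow> 'e \<Rightarrow> real"
  assumes q: "q = p A D * p D B / (\<Sum>E\<in>UNIV. p A E * p E B)" and q0: "0 < q" and u: "u < v"
  shows "real (u + 1) * (1 - q) * cell_sum ini p A B D n (Suc u) v (\<lambda>_. 1)
       = real (v - u) * q * cell_sum ini p A B D n u v (\<lambda>_. 1)"
proof -
  have "cell_sum ini p A B D n u v (\<lambda>z. \<Sum>i\<in>cands A B D n z. 1)
      = cell_sum ini p A B D n u v (\<lambda>z. real (v - u) * 1)"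
    by (rule cell_sum_cong) (simp add: card_cands cell_def)
  then have "real (v - u) * cell_sum ini p A B D n u v (\<lambda>_. 1)
      = (1 - q) / q * real (u + 1) * cell_sum ini p A B D n (Suc u) v (\<lambda>_. 1)"
    using cell_sum_swap[OF q q0, of ini n u v "\<lambda>_. 1"] unfolding cell_sum_cmult by simp
  then show ?thesis using q0 by (simp add: field_simps)
qed

text \<open>Masses and binomial probabilities obey the same recursion in \<open>u\<close>, hence are
  proportional; since the latter sum to 1, the factor is the total mass for
  \<open>v\<close>.\<close>

lemma cell_mass_binomial:
  fixes p :: "'e::finite \<Rightarrow> 'e \<Rightarrow> real"
  assumes q: "q = p A D * p D B / (\<Sum>E\<in>UNIV. p A E * p E B)" and q01: "0 < q" "q < 1" and u: "u \<le> v"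
  shows "cell_sum ini p A B D n u v (\<lambda>_. 1)
       = Bernstein v u q * (\<Sum>k\<le>v. cell_sum ini p A B D n k v (\<lambda>_. 1))"
proof -
  define W where "W k = cell_sum ini p A B D n k v (\<lambda>_. 1)" for k
  define c where "c = W 0 / (1 - q) ^ v"
  have W: "W k = Bernstein v k q * c" if "k \<le> v" for k
    using that
  proof (induction k)
    case 0
    then show ?case using q01 by (simp add: c_def Bernstein_def)
  next
    case (Suc k)
    let ?d = "real (k + 1) * (1 - q)"
    have "?d * W (Suc k) = real (v - k) * q * W k"
      unfolding W_def using Suc by (intro cell_mass_Suc q q01) auto
    also have "\<dots> = (real (v - k) * q * Bernstein v k q) * c" using Suc by simp
    also have "\<dots> = ?d * (Bernstein v (Suc k) q * c)"
      using Bernstein_Suc[of k v q] Suc by simp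
    finally have "?d * W (Suc k) = ?d * (Bernstein v (Suc k) q * c)" .
    moreover have "?d \<noteq> 0" using q01 by simp
    ultimately show ?case by (metis mult_left_cancel)
  qed
  then have "(\<Sum>k\<le>v. W k) = (\<Sum>k\<le>v. Bernstein v k q * c)" by (intro sum.cong) auto
  also have "\<dots> = c" by (simp flip: sum_distrib_right)
  finally show ?thesis using W[OF u] by (simp add: W_def)
qed

text \<open>The mean score after filling a random candidate on cell \<open>u\<close> is the mean on
  cell \<open>Suc u\<close>: the resampling identity transports the weighted sum of scores, the mass
  recursion the normalisation.\<close>

lemma cell_mean_drift:
  fixes p :: "'a::finite \<times> 'a \<Rightarrow> 'a \<times> 'a \<Rightarrow> real" and n v :: nat
    and S :: "'a \<Rightarrow> 'a \<Rightarrow> real" and \<delta> :: real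
  assumes q: "q = p A D * p D B / (\<Sum>E\<in>UNIV. p A E * p E B)" and q01: "0 < q" "q < 1" and u: "u < v"
    and W: "0 < cell_sum ini p A B D n u v (\<lambda>_. 1)"
  defines "l \<equiv> \<lambda>k. cell_sum ini p A B D n k v (LS S \<delta> n) / cell_sum ini p A B D n k v (\<lambda>_. 1)"
  shows "l (Suc u) - l u
       = cell_sum ini p A B D n u v (R_gain S \<delta> A B D n) / cell_sum ini p A B D n u v (\<lambda>_. 1)"
proof -
  let ?cs = "cell_sum ini p A B D n" and ?L = "LS S \<delta> n"
  define w where "w = ?cs u v (\<lambda>_. 1)"
  define w' where "w' = ?cs (Suc u) v (\<lambda>_. 1)"
  define s where "s = ?cs (Suc u) v ?L"
  have w: "0 < w" using W by (simp add: w_def)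
  have rec: "real (u + 1) * (1 - q) * w' = real (v - u) * q * w"
    unfolding w_def w'_def by (rule cell_mass_Suc[OF q q01(1) u])
  have "?cs u v (R_gain S \<delta> A B D n)
      = ?cs u v (\<lambda>z. 1 / real (v - u) * (\<Sum>i\<in>cands A B D n z. ?L (z(3 * i - 1 := D))) + (-1) * ?L z)"
    using u by (intro cell_sum_cong)
      (simp add: cell_def R_gain_def card_cands sum_subtractf diff_divide_distrib)
  also have "\<dots> = 1 / real (v - u) * ((1 - q) / q * real (u + 1) * s) - ?cs u v ?L"
    unfolding cell_sum_add cell_sum_cmult cell_sum_swap[OF q q01(1)] s_def by simp
  finally have gain: "?cs u v (R_gain S \<delta> A B D n)
      = 1 / real (v - u) * ((1 - q) / q * real (u + 1) * s) - ?cs u v ?L" .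
  have pos: "0 < real (v - u) * q * w" using u q01 w by simp
  have w'0: "w' \<noteq> 0" using rec pos by auto
  have "1 / real (v - u) * ((1 - q) / q * real (u + 1) * s) / w
      = (real (u + 1) * (1 - q)) * s / (real (v - u) * q * w)"
    by (simp add: divide_simps)
  also have "\<dots> = (real (u + 1) * (1 - q)) * s / (real (u + 1) * (1 - q) * w')"
    using rec by simp
  also have "\<dots> = s / w'" using q01 by simp
  finally show ?thesis
    unfolding l_def gain diff_divide_distrib by (simp add: w_def w'_def s_def)
qed

text \<open>All values close to \<open>m\<close> are taken between the first and the last such
  index. There \<open>l\<close> changes by less than \<open>2 * x\<close>, while telescoping makes
  it grow by \<open>\<epsilon>\<close> per step up to the total loss from \<open>\<beta>\<close>;
  this bounds the distance of the two indices.\<close>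

lemma card_small_values:
  fixes l \<beta> :: "nat \<Rightarrow> real"
  assumes \<epsilon>: "0 < \<epsilon>" and H: "0 \<le> H" and x: "0 \<le> x"
    and \<beta>: "\<And>u. u \<in> {a..b} \<Longrightarrow> 0 \<le> \<beta> u"
    and step: "\<And>u. a \<le> u \<Longrightarrow> u < b \<Longrightarrow> \<epsilon> - H * \<beta> u \<le> l (Suc u) - l u"
  shows "real (card {u\<in>{a..b}. \<bar>l u - m\<bar> < x}) \<le> 1 + (2 * x + H * (\<Sum>u\<in>{a..b}. \<beta> u)) / \<epsilon>"
proof (cases "{u\<in>{a..b}. \<bar>l u - m\<bar> < x} = {}")
  case True
  have "0 \<le> (2 * x + H * (\<Sum>u\<in>{a..b}. \<beta> u)) / \<epsilon>"
    using \<epsilon> H x \<beta> by (intro divide_nonneg_pos add_nonneg_nonneg mult_nonneg_nonneg sum_nonneg) auto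
  then show ?thesis unfolding True by simp
next
  case False
  define T where "T = {u\<in>{a..b}. \<bar>l u - m\<bar> < x}"
  have T: "finite T" "T \<noteq> {}" using False by (auto simp: T_def)
  define u1 where "u1 = Min T"
  define u2 where "u2 = Max T"
  have "u1 \<in> T" "u2 \<in> T" unfolding u1_def u2_def using T by auto
  then have u: "a \<le> u1" "u2 \<le> b" "\<bar>l u1 - m\<bar> < x" "\<bar>l u2 - m\<bar> < x" by (auto simp: T_def)
  have le: "u1 \<le> u2" unfolding u1_def using T \<open>u2 \<in> T\<close> by simp
  have "T \<subseteq> {u1..u2}" unfolding u1_def u2_def using T by auto
  from card_mono[OF _ this] have card: "real (card T) \<le> real u2 - real u1 + 1" using le by simp
  have "\<epsilon> * (real u2 - real u1) - H * (\<Sum>u\<in>{u1..<u2}. \<beta> u) = (\<Sum>u\<in>{u1..<u2}. \<epsilon> - H * \<beta> u)"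
    using le by (simp add: sum_subtractf of_nat_diff flip: sum_distrib_left)
  also have "\<dots> \<le> (\<Sum>u\<in>{u1..<u2}. l (Suc u) - l u)"
    using u by (intro sum_mono step) auto
  also have "\<dots> = l u2 - l u1" using le by (simp add: sum_Suc_diff')
  also have "\<dots> \<le> 2 * x" using u by linarith
  finally have "\<epsilon> * (real u2 - real u1) \<le> 2 * x + H * (\<Sum>u\<in>{u1..<u2}. \<beta> u)" by simp
  also have "\<dots> \<le> 2 * x + H * (\<Sum>u\<in>{a..b}. \<beta> u)"
    using u \<beta> H by (intro add_left_mono mult_left_mono sum_mono2) auto
  finally have "real u2 - real u1 \<le> (2 * x + H * (\<Sum>u\<in>{a..b}. \<beta> u)) / \<epsilon>"
    using \<epsilon> by (simp add: pos_le_divide_eq mult.commute)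
  then show ?thesis using card by (simp add: T_def)
qed

text \<open>Since the gain is at least \<open>\<epsilon>\<close> off the bad event and at least
  \<open>- K\<close> on it, the conditional means drift upwards by \<open>\<epsilon>\<close> minus
  \<open>K + \<epsilon>\<close> times the conditional bad probability. Few indices of the window are
  then near \<open>m\<close>, and each other one has at least the share \<open>\<kappa>\<close> of
  the total mass. The same share bounds the conditional bad probabilities by absolute ones, so
  \<open>\<kappa>\<close> cancels in the error term.\<close>

lemma window_mass:
  fixes p :: "'a::finite \<times> 'a \<Rightarrow> 'a \<times> 'a \<Rightarrow> real" and n v a b :: nat and m :: real
    and S :: "'a \<Rightarrow> 'a \<Rightarrow> real" and \<delta> :: real
  assumes st: "stochastic_matrix p" and stat: "stationary_dist ini p"
    and q: "q = p A D * p D B / (\<Sum>E\<in>UNIV. p A E * p E B)" and q01: "0 < q" "q < 1"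
    and b: "b \<le> v" and \<epsilon>: "0 < \<epsilon>" and x: "0 \<le> x"
    and K: "0 \<le> K" "\<And>z. \<bar>R_gain S \<delta> A B D n z\<bar> \<le> K"
    and \<kappa>: "0 < \<kappa>" "\<And>u. u \<in> {a..b} \<Longrightarrow> \<kappa> \<le> Bernstein v u q"
  defines "W \<equiv> \<lambda>u. cell_sum ini p A B D n u v (\<lambda>_. 1)"
    and "bad \<equiv> \<lambda>u. cell_sum ini p A B D n u v (\<lambda>z. of_bool (R_gain S \<delta> A B D n z < \<epsilon>))"
  shows "\<kappa> * (real (card {a..b}) - 1 - 2 * x / \<epsilon>) * (\<Sum>u\<le>v. W u) - (K / \<epsilon> + 1) * (\<Sum>u\<le>v. bad u)
     \<le> (\<Sum>u | u \<in> {a..b} \<and> x \<le> \<bar>cell_sum ini p A B D n u v (LS S \<delta> n) / W u - m\<bar>. W u)"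
proof -
  define l where "l u = cell_sum ini p A B D n u v (LS S \<delta> n) / W u" for u
  define Wv where "Wv = (\<Sum>u\<le>v. W u)"
  define Bv where "Bv = (\<Sum>u\<le>v. bad u)"
  define J where "J = {a..b}"
  define far where "far = {u. u \<in> J \<and> x \<le> \<bar>l u - m\<bar>}"
  define near where "near = {u\<in>J. \<bar>l u - m\<bar> < x}"
  have finJ: "finite J" "far \<subseteq> J" "near \<subseteq> J" by (auto simp: J_def far_def near_def)
  have W0: "0 \<le> W u" for u unfolding W_def by (intro cell_sum_nonneg st stat) simp
  have bad0: "0 \<le> bad u" for u unfolding bad_def by (intro cell_sum_nonneg st stat) simp
  have Wv0: "0 \<le> Wv" and Bv0: "0 \<le> Bv" unfolding Wv_def Bv_def by (auto intro: sum_nonneg W0 bad0)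
  have "\<kappa> * (real (card J) - 1 - 2 * x / \<epsilon>) * Wv - (K / \<epsilon> + 1) * Bv \<le> (\<Sum>u\<in>far. W u)"
  \<comment> \<open>Without mass for this \<open>v\<close> the quotients mean nothing, but the left
    side is not positive.\<close>
  proof (cases "Wv = 0")
    case True
    have "0 \<le> (K / \<epsilon> + 1) * Bv" using K(1) \<epsilon> Bv0 by simp
    moreover have "0 \<le> (\<Sum>u\<in>far. W u)" by (intro sum_nonneg W0)
    ultimately show ?thesis using True by simp
  next
    case False
    then have Wvp: "0 < Wv" using Wv0 by simp
    have W: "W u = Bernstein v u q * Wv" if "u \<le> v" for u
      unfolding W_def Wv_def by (rule cell_mass_binomial[OF q q01 that])
    have Wlow: "\<kappa> * Wv \<le> W u" if "u \<in> J" for u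
      using \<kappa>(2)[of u] W[of u] that b Wvp by (simp add: J_def)
    have kW: "0 < \<kappa> * Wv" using \<kappa>(1) Wvp by simp
    then have Wpos: "0 < W u" if "u \<in> J" for u using Wlow[OF that] by linarith
    define \<beta> where "\<beta> u = bad u / W u" for u
    have "\<epsilon> - (K + \<epsilon>) * \<beta> u \<le> l (Suc u) - l u" if u: "a \<le> u" "u < b" for u
    proof -
      have Wu: "0 < W u" using u by (intro Wpos) (simp add: J_def)
      have "\<epsilon> * W u - (K + \<epsilon>) * bad u
          = cell_sum ini p A B D n u v (\<lambda>z. \<epsilon> * 1 + (- (K + \<epsilon>)) * of_bool (R_gain S \<delta> A B D n z < \<epsilon>))"
        unfolding cell_sum_add cell_sum_cmult W_def bad_def by (simp add: algebra_simps)
      also have "\<dots> \<le> cell_sum ini p A B D n u v (R_gain S \<delta> A B D n)"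
      proof (rule cell_sum_mono[OF st stat])
        fix z
        show "\<epsilon> * 1 + (- (K + \<epsilon>)) * of_bool (R_gain S \<delta> A B D n z < \<epsilon>) \<le> R_gain S \<delta> A B D n z"
          using K(2)[of z] by (cases "R_gain S \<delta> A B D n z < \<epsilon>") auto
      qed
      finally have "(\<epsilon> * W u - (K + \<epsilon>) * bad u) / W u
          \<le> cell_sum ini p A B D n u v (R_gain S \<delta> A B D n) / W u"
        using Wu by (intro divide_right_mono) auto
      also have "\<dots> = l (Suc u) - l u"
        unfolding l_def W_def using u b Wu
        by (intro cell_mean_drift[OF q q01, symmetric]) (auto simp: W_def)
      finally show ?thesis using Wu by (simp add: \<beta>_def diff_divide_distrib)
    qed
    then have near: "real (card near) \<le> 1 + (2 * x + (K + \<epsilon>) * (\<Sum>u\<in>J. \<beta> u)) / \<epsilon>"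
      unfolding near_def J_def using \<epsilon> K x bad0 W0
      by (intro card_small_values) (auto simp: \<beta>_def)
    have \<beta>sum: "\<kappa> * Wv * (\<Sum>u\<in>J. \<beta> u) \<le> Bv"
    proof -
      have "\<kappa> * Wv * (\<Sum>u\<in>J. \<beta> u) = (\<Sum>u\<in>J. \<kappa> * Wv * \<beta> u)" by (simp add: sum_distrib_left)
      also have "\<dots> \<le> (\<Sum>u\<in>J. bad u)"
      proof (rule sum_mono)
        fix u assume u: "u \<in> J"
        have "\<kappa> * Wv * \<beta> u \<le> W u * \<beta> u"
          using Wlow[OF u] Wpos[OF u] bad0 by (intro mult_right_mono) (auto simp: \<beta>_def)
        also have "\<dots> = bad u" using Wpos[OF u] by (simp add: \<beta>_def)
        finally show "\<kappa> * Wv * \<beta> u \<le> bad u" .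
      qed
      also have "\<dots> \<le> Bv"
        unfolding Bv_def using b bad0 by (intro sum_mono2) (auto simp: J_def)
      finally show ?thesis .
    qed
    have "far = J - near" by (auto simp: far_def near_def)
    then have card: "real (card far) = real (card J) - real (card near)"
      using finJ by (simp add: card_Diff_subset finite_subset of_nat_diff card_mono)
    have "\<kappa> * (real (card J) - 1 - 2 * x / \<epsilon>) * Wv - (K / \<epsilon> + 1) * Bv
        \<le> \<kappa> * (real (card J) - 1 - 2 * x / \<epsilon>) * Wv - (K / \<epsilon> + 1) * (\<kappa> * Wv * (\<Sum>u\<in>J. \<beta> u))"
      using \<beta>sum K(1) \<epsilon> by (intro diff_left_mono mult_left_mono) auto
    also have "\<dots> = \<kappa> * Wv * (real (card J) - (1 + (2 * x + (K + \<epsilon>) * (\<Sum>u\<in>J. \<beta> u)) / \<epsilon>))"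
      using \<epsilon> by (simp add: field_simps)
    also have "\<dots> \<le> \<kappa> * Wv * real (card far)"
      using near card kW by (intro mult_left_mono) auto
    also have "\<dots> = (\<Sum>u\<in>far. \<kappa> * Wv)" by simp
    also have "\<dots> \<le> (\<Sum>u\<in>far. W u)" using finJ by (intro sum_mono Wlow) auto
    finally show ?thesis .
  qed
  then show ?thesis by (simp add: far_def J_def l_def Wv_def Bv_def)
qed

lemma binomial_window:
  assumes q: "0 < q" "q < 1"
  shows "\<forall>\<^sub>F v in sequentially. \<exists>a b. b \<le> v \<and> sqrt (real v) / 2 - 1 \<le> real (card {a..b}) \<and>
     (\<forall>u\<in>{a..b}. exp (- (5 / (16 * (q * (1 - q))))) / 3 / sqrt (real v) \<le> Bernstein v u q)"
proof -
  have sq: "filterlim (\<lambda>v. sqrt (real v)) at_top sequentially" by real_asymp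
  have "\<forall>\<^sub>F v in sequentially. 1 / (4 * (1 - q)) \<le> sqrt (real v)"
       "\<forall>\<^sub>F v in sequentially. 1 / (4 * q) \<le> sqrt (real v)"
    using sq by (simp_all add: filterlim_at_top)
  with Bernstein_lower_bound[OF q] show ?thesis
  proof eventually_elim
    case (elim v)
    define y where "y = sqrt (real v)"
    have y: "0 \<le> y" "real v = y * y" by (auto simp: y_def)
    define a where "a = nat \<lceil>real v * q - y / 4\<rceil>"
    define b where "b = nat \<lfloor>real v * q + y / 4\<rfloor>"
    have "1 / 4 \<le> y * (1 - q)" "1 / 4 \<le> y * q"
      using elim(2,3) q by (simp_all add: y_def field_simps)
    then have "y * (1 / 4) \<le> y * (y * (1 - q))" "y * (1 / 4) \<le> y * (y * q)"
      using y(1) by (intro mult_left_mono; simp)+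
    then have vq: "real v * q + y / 4 \<le> real v" "0 \<le> real v * q - y / 4"
      unfolding y(2) by (simp_all add: algebra_simps)
    have b: "real b \<le> real v * q + y / 4" "real v * q + y / 4 - 1 \<le> real b"
      unfolding b_def using vq y(1) by linarith+
    have a: "real v * q - y / 4 \<le> real a" "real a \<le> real v * q - y / 4 + 1"
      unfolding a_def using vq y(1) by linarith+
    have bv: "b \<le> v" using b vq by linarith
    have "\<bar>real u - real v * q\<bar> \<le> y / 4" if "u \<in> {a..b}" for u
    proof -
      have "real a \<le> real u" "real u \<le> real b" using that by auto
      then show ?thesis using a(1) b(1) unfolding abs_le_iff by linarith
    qed
    \<comment> \<open>The interval has length \<open>y / 2\<close>; rounding costs up to 1 at each
      end, and counting both endpoints gives 1 back.\<close>
    moreover have "y / 2 - 1 \<le> real (card {a..b})"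
      using a b by simp
    ultimately show ?case
      using elim(1) bv unfolding y_def
      by (intro exI[of _ a] exI[of _ b]) auto
  qed
qed

text \<open>With \<open>s = q * (1 - q)\<close> and \<open>sqrt (2 * \<alpha>) \<le> 1\<close> it
  suffices that \<open>sqrt (2 * pi * s) * exp (3 / (16 * s)) \<ge> 3 / 2\<close>, where 3/16 = 1/2
  - 5/16. Squaring and using \<open>exp t \<ge> t\<close> reduces this to
  \<open>3 * pi / 4 \<ge> 9 / 4\<close>.\<close>

lemma target_constant_le:
  fixes q \<alpha> :: real
  assumes q: "0 < q" "q < 1" and \<alpha>: "\<alpha> \<le> 1 / 3"
  shows "sqrt (2 * \<alpha>) / (8 * (sqrt (2 * pi * q * (1 - q)) * exp (1 / (2 * q * (1 - q)))))
       \<le> exp (- (5 / (16 * (q * (1 - q))))) / 3 / 4"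
proof -
  define s where "s = q * (1 - q)"
  define b where "b = sqrt (2 * pi * s) * exp (1 / (2 * s))"
  have s: "0 < s" using q by (simp add: s_def)
  have b: "0 < b" unfolding b_def using s by simp
  have "3 / 2 \<le> sqrt (2 * pi * s) * exp (3 / (16 * s))"
  proof (rule power2_le_imp_le)
    have "(3 / 2)\<^sup>2 \<le> 2 * pi * s * (3 / (8 * s))"
      using s pi_gt3 by (simp add: power2_eq_square)
    also have "\<dots> \<le> 2 * pi * s * exp (3 / (8 * s))"
    proof (rule mult_left_mono)
      show "3 / (8 * s) \<le> exp (3 / (8 * s))"
        using exp_ge_add_one_self[of "3 / (8 * s)"] by linarith
    qed (use s in simp)
    also have "\<dots> = (sqrt (2 * pi * s) * exp (3 / (16 * s)))\<^sup>2"
      using s by (simp add: power_mult_distrib flip: exp_double)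
    finally show "(3 / 2)\<^sup>2 \<le> (sqrt (2 * pi * s) * exp (3 / (16 * s)))\<^sup>2" .
  qed (use s in simp)
  also have "\<dots> = exp (- (5 / (16 * s))) * b"
    unfolding b_def using s by (simp add: mult_ac flip: exp_add)
  finally have *: "3 / 2 \<le> exp (- (5 / (16 * s))) * b" .
  have "sqrt (2 * \<alpha>) \<le> 1" using \<alpha> by simp
  then have "sqrt (2 * \<alpha>) / (8 * b) \<le> 1 / (8 * b)" using b by (intro divide_right_mono) auto
  also have "\<dots> \<le> exp (- (5 / (16 * s))) / 3 / 4" using b * by (simp add: field_simps)
  finally show ?thesis by (simp add: b_def s_def mult.assoc)
qed

subsection \<open>Lower bound for the moments\<close>

theorem theorem3p3:
  fixes S :: "'a::finite \<Rightarrow> 'a \<Rightarrow> real" and \<delta> :: real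
    and p :: "'a \<times> 'a \<Rightarrow> 'a \<times> 'a \<Rightarrow> real" and ini :: "'a \<times> 'a \<Rightarrow> real"
    and A B D :: "'a \<times> 'a"
    and \<Phi> :: "real \<Rightarrow> real" and \<mu> :: "nat \<Rightarrow> real" and \<epsilon>o :: real
  assumes S_nonneg: "\<forall>x y. 0 \<le> S x y"
    and stoch: "stochastic_matrix p"
    and prim: "primitive_matrix p"
    and stat: "stationary_dist ini p"
    and AB_pos: "mc_prob ini p 3 (\<lambda>z. z 1 = A \<and> z 3 = B) > 0"
    and q_pos: "0 < p A D * p D B / (\<Sum>D'\<in>UNIV. p A D' * p D' B)"
    and q_lt1: "p A D * p D B / (\<Sum>D'\<in>UNIV. p A D' * p D' B) < 1"
    and Phi_convex: "convex_on {0..} \<Phi>"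
    and Phi_mono: "mono_on {0..} \<Phi>"
    and Phi_nonneg: "\<forall>x\<ge>0. 0 \<le> \<Phi> x"
    and eps_pos: "\<epsilon>o > 0"
    and A1: "\<exists>\<Delta>::nat \<Rightarrow> real. \<Delta> \<longlonglongrightarrow> 0 \<and>
              (\<forall>n. mc_prob ini p n (\<lambda>z. R_gain S \<delta> A B D n z \<ge> \<epsilon>o) \<ge> 1 - \<Delta> n)"
  shows "let \<alpha> = mc_prob ini p 3 (\<lambda>z. z 1 = A \<and> z 3 = B) / 3;
             q = p A D * p D B / (\<Sum>D'\<in>UNIV. p A D' * p D' B);
             b = sqrt (2 * pi * q * (1 - q)) * exp (1 / (2 * q * (1 - q)))
         in \<forall>c. 0 < c \<and> c < sqrt (2 * \<alpha>) / (8 * b) \<longrightarrow>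
              (\<forall>\<^sub>F n in sequentially.
                 mc_expect ini p n (\<lambda>z. \<Phi> \<bar>LS S \<delta> n z - \<mu> n\<bar>)
                   \<ge> c * \<Phi> (\<epsilon>o * sqrt (2 * \<alpha> * real n) / 16))"
proof -
  define \<beta> where "\<beta> = mc_prob ini p 3 (\<lambda>z. z 1 = A \<and> z 3 = B)"
  define \<alpha> where "\<alpha> = \<beta> / 3"
  define q where "q = p A D * p D B / (\<Sum>D'\<in>UNIV. p A D' * p D' B)"
  define \<kappa> where "\<kappa> = exp (- (5 / (16 * (q * (1 - q))))) / 3"
  have q01: "0 < q" "q < 1" using q_pos q_lt1 by (simp_all add: q_def)
  have \<beta>: "\<beta> = ini A * mpow p 2 A B" "0 < \<beta>" "\<beta> \<le> 1"
    unfolding \<beta>_def by (rule mc_prob_AB[OF stoch stat], rule AB_pos, rule mc_prob_le_1[OF stoch stat], simp)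
  have \<alpha>: "0 < \<alpha>" "\<alpha> \<le> 1 / 3" using \<beta> by (auto simp: \<alpha>_def)
  have \<kappa>0: "0 < \<kappa>" by (simp add: \<kappa>_def)
  obtain \<Delta> :: "nat \<Rightarrow> real" where \<Delta>: "\<Delta> \<longlonglongrightarrow> 0"
    "\<And>n. mc_prob ini p n (\<lambda>z. R_gain S \<delta> A B D n z \<ge> \<epsilon>o) \<ge> 1 - \<Delta> n"
    using A1 by blast
  obtain K where K: "0 \<le> K" "\<And>\<delta> A B D n z. \<bar>R_gain S \<delta> A B D n z\<bar> \<le> K"
    using R_gain_bounded[OF S_nonneg] by blast
  define tail where "tail n = mc_prob ini p n (\<lambda>z. real (vcnt A B n z) < \<beta> * real n / 6)" for n
  \<comment> \<open>Share of far indices for a given \<open>v\<close>: about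
    \<open>sqrt v / 2\<close> indices in the window, at most \<open>sqrt v / 4\<close> of them near
    up to rounding, each of weight \<open>\<kappa> / sqrt v\<close>. The limit is
    \<open>\<kappa> / 4\<close>; the correction collects the rounding.\<close>
  define \<rho> where "\<rho> n = \<kappa> * (1 / 4 - 2 / sqrt (\<alpha> * real n / 2))" for n
  define \<theta> where "\<theta> n = \<rho> n * (1 - tail n) - (K / \<epsilon>o + 1) * \<Delta> n" for n
  have tail: "tail \<longlonglongrightarrow> 0"
    unfolding tail_def using vcnt_lower_tail[OF stoch prim stat \<beta>(1,2)] .
  have "(\<lambda>n. 2 / sqrt (\<alpha> * real n / 2)) \<longlonglongrightarrow> 0" using \<alpha>(1) by real_asymp
  then have \<rho>lim: "\<rho> \<longlonglongrightarrow> \<kappa> * (1 / 4 - 0)"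
    unfolding \<rho>_def by (intro tendsto_intros)
  then have \<theta>lim: "\<theta> \<longlonglongrightarrow> \<kappa> * (1 / 4 - 0) * (1 - 0) - (K / \<epsilon>o + 1) * 0"
    unfolding \<theta>_def by (intro tendsto_intros tail \<Delta>(1))

  have main: "\<theta> n * \<Phi> (\<epsilon>o * sqrt (2 * \<alpha> * real n) / 16)
      \<le> mc_expect ini p n (\<lambda>z. \<Phi> \<bar>LS S \<delta> n z - \<mu> n\<bar>)"
    if n: "1 \<le> n" "0 \<le> \<rho> n"
      and window: "\<And>v. \<alpha> * real n / 2 \<le> real v \<Longrightarrow> \<exists>a b. b \<le> v \<and> sqrt (real v) / 2 - 1 \<le> real (card {a..b}) \<and>
        (\<forall>u\<in>{a..b}. \<kappa> / sqrt (real v) \<le> Bernstein v u q)" for n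
  proof -
    let ?cs = "cell_sum ini p A B D n"
    define x where "x = \<epsilon>o * sqrt (2 * \<alpha> * real n) / 16"
    have x: "0 \<le> x" using eps_pos \<alpha> by (simp add: x_def)
    define W where "W u v = ?cs u v (\<lambda>_. 1)" for u v
    define bad where "bad u v = ?cs u v (\<lambda>z. of_bool (R_gain S \<delta> A B D n z < \<epsilon>o))" for u v
    define l where "l u v = ?cs u v (LS S \<delta> n) / W u v" for u v
    define F where "F z = \<Phi> \<bar>LS S \<delta> n z - \<mu> n\<bar>" for z
    define V where "V = {v. v \<le> n \<and> \<alpha> * real n / 2 \<le> real v}"
    have W0: "0 \<le> W u v" for u v unfolding W_def by (intro cell_sum_nonneg stoch stat) simp
    have bad0: "0 \<le> bad u v" for u v unfolding bad_def by (intro cell_sum_nonneg stoch stat) simp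
    have F0: "0 \<le> F z" for z using Phi_nonneg by (simp add: F_def)
    have F0': "0 \<le> ?cs u v F" for u v using F0 by (intro cell_sum_nonneg stoch stat)
    have \<Phi>x: "0 \<le> \<Phi> x" using Phi_nonneg x by simp
    have an: "0 < \<alpha> * real n / 2" using \<alpha> n by simp

    \<comment> \<open>The bad mass of a single \<open>v\<close> is not controlled and may make the
      left side negative; (A1) bounds it only after summation over \<open>v\<close>.\<close>
    have slice: "(\<rho> n * (\<Sum>u\<le>v. W u v) - (K / \<epsilon>o + 1) * (\<Sum>u\<le>v. bad u v)) * \<Phi> x \<le> (\<Sum>u\<le>v. ?cs u v F)"
      if v: "v \<in> V" for v
    proof -
      define y where "y = sqrt (real v)"
      have va: "\<alpha> * real n / 2 \<le> real v" using v by (simp add: V_def)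
      have y: "sqrt (\<alpha> * real n / 2) \<le> y" "0 < y" using va an by (auto simp: y_def)
      obtain a b where ab: "b \<le> v" "y / 2 - 1 \<le> real (card {a..b})"
          "\<And>u. u \<in> {a..b} \<Longrightarrow> \<kappa> / y \<le> Bernstein v u q"
        using window[OF va] unfolding y_def by blast
      define far where "far = {u. u \<in> {a..b} \<and> x \<le> \<bar>l u v - \<mu> n\<bar>}"
      have far: "far \<subseteq> {..v}" using ab(1) by (auto simp: far_def)
      have wm: "\<kappa> / y * (real (card {a..b}) - 1 - 2 * x / \<epsilon>o) * (\<Sum>u\<le>v. W u v)
            - (K / \<epsilon>o + 1) * (\<Sum>u\<le>v. bad u v) \<le> (\<Sum>u\<in>far. W u v)"
        unfolding far_def W_def bad_def l_def
        by (rule window_mass[OF stoch stat q_def q01 ab(1) eps_pos x K _ ab(3)]) (use \<kappa>0 y(2) in auto)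
      have "\<rho> n \<le> \<kappa> / y * (real (card {a..b}) - 1 - 2 * x / \<epsilon>o)"
      proof -
        \<comment> \<open>This is where the 16 in the theorem fits:
          \<open>2 * x / \<epsilon>o\<close> becomes a quarter of
          \<open>sqrt (\<alpha> * real n / 2)\<close>, hence at most half of the window.\<close>
        have "sqrt (2 * \<alpha> * real n) = 2 * sqrt (\<alpha> * real n / 2)"
          using real_sqrt_mult[of 4 "\<alpha> * real n / 2"] by (simp add: mult.assoc)
        then have "2 * x / \<epsilon>o \<le> y / 4" using y(1) eps_pos by (simp add: x_def)
        then have "y / 4 - 2 \<le> real (card {a..b}) - 1 - 2 * x / \<epsilon>o" using ab(2) by linarith
        then have "\<kappa> / y * (y / 4 - 2) \<le> \<kappa> / y * (real (card {a..b}) - 1 - 2 * x / \<epsilon>o)"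
          using \<kappa>0 y(2) by (intro mult_left_mono) auto
        moreover have "\<kappa> / y * (y / 4 - 2) = \<kappa> * (1 / 4 - 2 / y)"
          using y(2) by (simp add: field_simps)
        moreover have "2 / y \<le> 2 / sqrt (\<alpha> * real n / 2)"
          using y an by (intro divide_left_mono mult_pos_pos) auto
        then have "\<rho> n \<le> \<kappa> * (1 / 4 - 2 / y)"
          unfolding \<rho>_def using \<kappa>0 by (intro mult_left_mono) auto
        ultimately show ?thesis by linarith
      qed
      then have "\<rho> n * (\<Sum>u\<le>v. W u v)
          \<le> \<kappa> / y * (real (card {a..b}) - 1 - 2 * x / \<epsilon>o) * (\<Sum>u\<le>v. W u v)"
        by (intro mult_right_mono sum_nonneg W0)
      with wm have "\<rho> n * (\<Sum>u\<le>v. W u v) - (K / \<epsilon>o + 1) * (\<Sum>u\<le>v. bad u v) \<le> (\<Sum>u\<in>far. W u v)"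
        by linarith
      then have "(\<rho> n * (\<Sum>u\<le>v. W u v) - (K / \<epsilon>o + 1) * (\<Sum>u\<le>v. bad u v)) * \<Phi> x
          \<le> (\<Sum>u\<in>far. W u v) * \<Phi> x"
        using \<Phi>x by (rule mult_right_mono)
      also have "\<dots> = (\<Sum>u\<in>far. W u v * \<Phi> x)" by (simp add: sum_distrib_right)
      also have "\<dots> \<le> (\<Sum>u\<in>far. ?cs u v F)"
      proof (rule sum_mono)
        fix u assume u: "u \<in> far"
        show "W u v * \<Phi> x \<le> ?cs u v F"
        proof (cases "W u v = 0")
          case True
          then show ?thesis using F0' by simp
        next
          case False
          then have "0 < W u v" using W0[of u v] by simp
          have "W u v * \<Phi> x \<le> W u v * \<Phi> \<bar>l u v - \<mu> n\<bar>"
            using u x W0 by (intro mult_left_mono mono_onD[OF Phi_mono]) (auto simp: far_def)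
          also have "\<dots> \<le> ?cs u v F"
            unfolding W_def l_def F_def using \<open>0 < W u v\<close>
            by (intro cell_sum_jensen stoch stat Phi_convex Phi_mono) (simp add: W_def)
          finally show ?thesis .
        qed
      qed
      also have "\<dots> \<le> (\<Sum>u\<le>v. ?cs u v F)"
        using far F0' by (intro sum_mono2) auto
      finally show ?thesis .
    qed

    have V: "finite V" "V \<subseteq> {..n}" by (auto simp: V_def)
    have massV: "1 - tail n \<le> (\<Sum>v\<in>V. \<Sum>u\<le>v. W u v)"
    proof -
      have "1 = mc_expect ini p n (\<lambda>_. 1)" using mc_expect_const[OF stoch stat n(1), of 1] by simp
      also have "\<dots> = mc_expect ini p n (\<lambda>z. of_bool (real (vcnt A B n z) < \<beta> * real n / 6)
          + of_bool (vcnt A B n z \<in> V))"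
      proof (rule mc_expect_cong)
        fix z :: "nat \<Rightarrow> 'a \<times> 'a"
        \<comment> \<open>The two events are complementary because
          \<open>\<beta> * real n / 6\<close> equals \<open>\<alpha> * real n / 2\<close>.\<close>
        show "1 = of_bool (real (vcnt A B n z) < \<beta> * real n / 6)
          + (of_bool (vcnt A B n z \<in> V) :: real)" by (auto simp: V_def \<alpha>_def vcnt_le)
      qed
      also have "\<dots> = tail n + mc_expect ini p n (\<lambda>z. of_bool (vcnt A B n z \<in> V))"
        by (simp add: mc_expect_add tail_def mc_prob_eq_expect)
      also have "mc_expect ini p n (\<lambda>z. of_bool (vcnt A B n z \<in> V))
          = (\<Sum>v\<le>n. \<Sum>u\<le>v. ?cs u v (\<lambda>z. of_bool (vcnt A B n z \<in> V)))"
        by (rule mc_expect_cells)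
      also have "\<dots> = (\<Sum>v\<le>n. if v \<in> V then \<Sum>u\<le>v. W u v else 0)"
      proof (rule sum.cong[OF refl])
        fix v
        have "?cs u v (\<lambda>z. of_bool (vcnt A B n z \<in> V)) = ?cs u v (\<lambda>z. of_bool (v \<in> V) * 1)" for u
          by (rule cell_sum_cong) (auto simp: cell_def)
        then show "(\<Sum>u\<le>v. ?cs u v (\<lambda>z. of_bool (vcnt A B n z \<in> V)))
            = (if v \<in> V then \<Sum>u\<le>v. W u v else 0)"
          unfolding cell_sum_cmult by (auto simp: W_def)
      qed
      also have "\<dots> = (\<Sum>v\<in>V. \<Sum>u\<le>v. W u v)"
        using V(2) by (simp add: sum.If_cases Int_absorb1)
      finally show ?thesis by simp
    qed
    have badV: "(\<Sum>v\<in>V. \<Sum>u\<le>v. bad u v) \<le> \<Delta> n"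
    proof -
      have "(\<Sum>v\<in>V. \<Sum>u\<le>v. bad u v) \<le> (\<Sum>v\<le>n. \<Sum>u\<le>v. bad u v)"
        using V bad0 by (intro sum_mono2) (auto intro: sum_nonneg)
      also have "\<dots> = mc_expect ini p n (\<lambda>z. of_bool (R_gain S \<delta> A B D n z < \<epsilon>o))"
        unfolding bad_def by (rule mc_expect_cells[symmetric])
      also have "\<dots> = mc_expect ini p n (\<lambda>z. 1 + (-1) * of_bool (R_gain S \<delta> A B D n z \<ge> \<epsilon>o))"
        by (intro mc_expect_cong) auto
      also have "\<dots> = 1 - mc_prob ini p n (\<lambda>z. R_gain S \<delta> A B D n z \<ge> \<epsilon>o)"
        unfolding mc_expect_add mc_expect_cmult mc_prob_eq_expect
        using mc_expect_const[OF stoch stat n(1), of 1] by simp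
      also have "\<dots> \<le> \<Delta> n" using \<Delta>(2)[of n] by simp
      finally show ?thesis .
    qed
    have "\<theta> n \<le> \<rho> n * (\<Sum>v\<in>V. \<Sum>u\<le>v. W u v) - (K / \<epsilon>o + 1) * (\<Sum>v\<in>V. \<Sum>u\<le>v. bad u v)"
      unfolding \<theta>_def using massV badV n(2) K(1) eps_pos by (intro diff_mono mult_left_mono) auto
    then have "\<theta> n * \<Phi> x
        \<le> (\<rho> n * (\<Sum>v\<in>V. \<Sum>u\<le>v. W u v) - (K / \<epsilon>o + 1) * (\<Sum>v\<in>V. \<Sum>u\<le>v. bad u v)) * \<Phi> x"
      using \<Phi>x by (rule mult_right_mono)
    also have "\<dots> = (\<Sum>v\<in>V. (\<rho> n * (\<Sum>u\<le>v. W u v) - (K / \<epsilon>o + 1) * (\<Sum>u\<le>v. bad u v)) * \<Phi> x)"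
      unfolding sum_distrib_right[symmetric] sum_subtractf sum_distrib_left[symmetric] ..
    also have "\<dots> \<le> (\<Sum>v\<in>V. \<Sum>u\<le>v. ?cs u v F)" by (rule sum_mono[OF slice])
    also have "\<dots> \<le> (\<Sum>v\<le>n. \<Sum>u\<le>v. ?cs u v F)"
      using V F0' by (intro sum_mono2) (auto intro: sum_nonneg)
    also have "\<dots> = mc_expect ini p n F" by (rule mc_expect_cells[symmetric])
    finally show ?thesis by (simp add: x_def F_def[abs_def])
  qed

  obtain N where N: "\<And>v. N \<le> v \<Longrightarrow> \<exists>a b. b \<le> v \<and> sqrt (real v) / 2 - 1 \<le> real (card {a..b}) \<and>
     (\<forall>u\<in>{a..b}. \<kappa> / sqrt (real v) \<le> Bernstein v u q)"
    using binomial_window[OF q01] unfolding \<kappa>_def eventually_sequentially by blast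
  \<comment> \<open>The threshold for \<open>v\<close> becomes one for \<open>n\<close>, since only
    \<open>v\<close> of order at least \<open>n\<close> are considered.\<close>
  have large: "\<forall>\<^sub>F n in sequentially. real N \<le> \<alpha> * real n / 2"
    using \<alpha>(1) by real_asymp
  have "\<forall>\<^sub>F n in sequentially. c * \<Phi> (\<epsilon>o * sqrt (2 * \<alpha> * real n) / 16)
      \<le> mc_expect ini p n (\<lambda>z. \<Phi> \<bar>LS S \<delta> n z - \<mu> n\<bar>)" if c: "c < \<kappa> / 4" for c
  proof -
    have "\<forall>\<^sub>F n in sequentially. c < \<theta> n"
      by (rule order_tendstoD(1)[OF \<theta>lim]) (use c in simp)
    moreover have "\<forall>\<^sub>F n in sequentially. 0 < \<rho> n"
      by (rule order_tendstoD(1)[OF \<rho>lim]) (use \<kappa>0 in simp)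
    ultimately show ?thesis
      using large eventually_ge_at_top[of 1]
    proof eventually_elim
      case (elim n)
      have "c * \<Phi> (\<epsilon>o * sqrt (2 * \<alpha> * real n) / 16) \<le> \<theta> n * \<Phi> (\<epsilon>o * sqrt (2 * \<alpha> * real n) / 16)"
        using elim Phi_nonneg eps_pos \<alpha> by (intro mult_right_mono) auto
      also have "\<dots> \<le> mc_expect ini p n (\<lambda>z. \<Phi> \<bar>LS S \<delta> n z - \<mu> n\<bar>)"
        using elim by (intro main N) auto
      finally show ?case .
    qed
  qed
  then show ?thesis
    using target_constant_le[OF q01 \<alpha>(2)]
    unfolding Let_def \<beta>_def[symmetric] \<alpha>_def[symmetric] q_def[symmetric] \<kappa>_def
    by (meson less_le_trans)
qed

end
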